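(* Let $1<p<\infty$ and let $p'$ be the conjugate exponent of $p$. Let $\mathcal{D}$ be the collection of dyadic cubes of $\mathbb{R}^d$ and let $(\lambda_Q)_{Q\in\mathcal{D}}$ be non-negative real numbers. Suppose that $\sigma$ and $\omega$ are locally integrable positive functions on $\mathbb{R}^d$. With the operators $S$ and $S_R$ associated with $(\lambda_Q)_{Q\in\mathcal{D}}$ as defined in the context, the two weight norm inequality $$\|S(f\sigma)\|_{L^p(\omega)}\leq\tilde{C}\,\|f\|_{L^p(\sigma)}\qquad\text{for all } f\in L^p(\sigma)$$ holds for some finite constant $\tilde C$ if and only if both of the following testing conditions hold for some finite constant $C$: $$\|S_R(\sigma)\|_{L^p(\omega)}\leq C\,\sigma(R)^{1/p}\qquad\text{for all } R\in\mathcal{D},$$ $$\|S_R(\omega)\|_{L^{p'}(\sigma)}\leq C\,\omega(R)^{1/p'}\qquad\text{for all } R\in\mathcal{D}.$$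
   Context: $\mathcal{D}$ is the standard collection of dyadic cubes of $\mathbb{R}^d$. For a locally integrable function $f$ and $Q\in\mathcal{D}$, $\langle f\rangle_Q:=\frac{1}{|Q|}\int_Q f\,dx$, where $|Q|$ is Lebesgue measure, and $1_Q$ is the indicator function of $Q$. For a weight $\sigma$ write $\sigma(R):=\int_R\sigma\,dx$, and $L^p(\sigma)$ is the space of functions $f$ on $\mathbb{R}^d$ with norm $(\int|f|^p\sigma\,dx)^{1/p}$; similarly for $\omega$. The operator $S$ is defined by $Sf:=|Tf|_1$, the $\ell^1(\mathcal{D})$ norm (pointwise in $x$) of the sequence $T(f):=(\lambda_Q\langle f\rangle_Q1_Q)_{Q\in\mathcal{D}}$; for $f\geq0$ this is $$Sf=\sum_{Q\in\mathcal{D}}\lambda_Q\langle f\rangle_Q1_Q .$$ For $R\in\mathcal{D}$ the localized operator $S_R$ is defined in the same way with only the cubes $Q\subseteq R$; for $f\geq 0$, $S_Rf=\sum_{Q\in\mathcal{D},\,Q\subseteq R}\lambda_Q\langle f\rangle_Q1_Q$. Here $S(f\sigma)$ is $S$ applied to the product $f\sigma$, and $S_R(\sigma)$, $S_R(\omega)$ are $S_R$ applied to the functions $\sigma$, $\omega$. *)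

theory Defs
  imports "HOL-Analysis.Analysis"
begin

text \<open>The half-open dyadic cube of side length \<open>2 powi (- k)\<close> with lower corner
  \<open>2 powi (- k) * m\<close>; all scales \<open>k \<in> \<int>\<close> occur.\<close>
definition dyadic_cube :: "int \<Rightarrow> int ^ 'n \<Rightarrow> (real ^ 'n) set" where
  "dyadic_cube k m =
     {x. \<forall>i. 2 powi (- k) * real_of_int (m $ i) \<le> x $ i \<and>
             x $ i < 2 powi (- k) * (real_of_int (m $ i) + 1)}"

definition dyadic_cubes :: "(real ^ 'n) set set" where
  "dyadic_cubes = {dyadic_cube k m | k m. True}"

definition locally_integrable :: "(real ^ 'n \<Rightarrow> real) \<Rightarrow> bool" where
  "locally_integrable f \<longleftrightarrow>
     f \<in> borel_measurable lebesgue \<and> (\<forall>K. compact K \<longrightarrow> set_integrable lebesgue K f)"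

definition average :: "(real ^ 'n) set \<Rightarrow> (real ^ 'n \<Rightarrow> real) \<Rightarrow> real" where
  "average Q f = 1 / measure lebesgue Q * (LINT x:Q|lebesgue. f x)"

definition T_seq ::
  "((real ^ 'n) set \<Rightarrow> real) \<Rightarrow> (real ^ 'n \<Rightarrow> real) \<Rightarrow> real ^ 'n \<Rightarrow> (real ^ 'n) set \<Rightarrow> real" where
  "T_seq lam f x Q = lam Q * average Q f * indicator Q x"

text \<open>The pointwise \<open>\<ell>\<^sup>1\<close> norm of the sequence may be infinite, hence the values
  in \<^typ>\<open>ennreal\<close>.\<close>
definition S_op ::
  "((real ^ 'n) set \<Rightarrow> real) \<Rightarrow> (real ^ 'n \<Rightarrow> real) \<Rightarrow> real ^ 'n \<Rightarrow> ennreal" where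
  "S_op lam f x = (\<Sum>\<^sub>\<infinity>Q\<in>dyadic_cubes. ennreal \<bar>T_seq lam f x Q\<bar>)"

definition S_loc ::
  "((real ^ 'n) set \<Rightarrow> real) \<Rightarrow> (real ^ 'n) set \<Rightarrow> (real ^ 'n \<Rightarrow> real) \<Rightarrow> real ^ 'n \<Rightarrow> ennreal" where
  "S_loc lam R f x = (\<Sum>\<^sub>\<infinity>Q\<in>{Q \<in> dyadic_cubes. Q \<subseteq> R}. ennreal \<bar>T_seq lam f x Q\<bar>)"

text \<open>Powers of extended non-negative reals; only used for exponents \<open>a > 0\<close>,
  where \<open>\<infinity>\<close> is mapped to \<open>\<infinity>\<close>.\<close>
definition epowr :: "ennreal \<Rightarrow> real \<Rightarrow> ennreal" where
  "epowr x a = (if x = \<infinity> then \<infinity> else ennreal (enn2real x powr a))"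

text \<open>The norm of \<open>L\<^sup>p(w)\<close>, as a function of the absolute value \<open>g = \<bar>f\<bar>\<close>.\<close>
definition Lp_norm :: "real \<Rightarrow> (real ^ 'n \<Rightarrow> real) \<Rightarrow> (real ^ 'n \<Rightarrow> ennreal) \<Rightarrow> ennreal" where
  "Lp_norm p w g = epowr (\<integral>\<^sup>+ x. epowr (g x) p * ennreal (w x) \<partial>lebesgue) (1 / p)"

definition Lp_space :: "real \<Rightarrow> (real ^ 'n \<Rightarrow> real) \<Rightarrow> (real ^ 'n \<Rightarrow> real) set" where
  "Lp_space p w =
     {f. f \<in> borel_measurable lebesgue \<and> Lp_norm p w (\<lambda>x. ennreal \<bar>f x\<bar>) < \<infinity>}"

definition weight_measure :: "(real ^ 'n \<Rightarrow> real) \<Rightarrow> (real ^ 'n) set \<Rightarrow> real" where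
  "weight_measure w R = (LINT x:R|lebesgue. w x)"

end

theory Submission
  imports Defs
begin

text \<open>Everything rests on two facts about dyadic cubes: any two of them are nested or
disjoint, and the operator \<open>S\<close> is self-adjoint with non-negative kernel. Write
\<open>q\<close> for the conjugate exponent \<open>p'\<close> and \<open>a Q = \<lambda>\<^sub>Q
/ |Q|\<close>; then the integral of \<open>S(f\<sigma>) g\<omega>\<close> is the bilinear form
\<open>\<Sum>Q. a Q * (\<integral>\<^sub>Q f\<sigma>) * (\<integral>\<^sub>Q g\<omega>)\<close>.

Necessity. The first testing condition is the norm inequality for \<open>f = 1\<^sub>R\<close>.
For the second one, take \<open>f = (S\<^sub>R \<omega>)\<^bsup>q-1\<^esup>\<close>: by
self-adjointness the integral of \<open>(S\<^sub>R \<omega>)\<^bsup>q\<^esup> \<sigma>\<close>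
is at most the integral of \<open>S(f\<sigma>) \<omega>\<close> over \<open>R\<close>, and this
is bounded, by the norm inequality and Young's inequality, by a small multiple of the integral
on the left plus a multiple of \<open>\<omega>(R)\<close>.

Sufficiency (a proof of S. Treil). It suffices to bound the bilinear form. Split the cubes into
those with \<open>(g-mean)\<^bsup>q\<^esup> \<omega>(Q) \<le> (f-mean)\<^bsup>p\<^esup>
\<sigma>(Q)\<close>, the means being taken with respect to \<open>\<omega>\<close> and
\<open>\<sigma>\<close>, and those with the opposite inequality; by symmetry consider the
former. Group them under principal cubes \<open>R\<close>, so that the means of \<open>f\<close>
in the group of \<open>R\<close> are at most twice its mean on \<open>R\<close>. In the group of
\<open>R\<close> every integral of \<open>g\<omega>\<close> may be computed after replacing
\<open>g\<close> by its mean on each of the principal cubes \<open>R'\<close> next below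
\<open>R\<close>. The testing condition at \<open>R\<close> then bounds the group by
\<open>(f-mean on R)\<^bsup>p\<^esup> \<sigma>(R)\<close>, plus the integral of
\<open>g\<^bsup>q\<^esup>\<omega>\<close> over the part of \<open>R\<close> outside the
\<open>R'\<close>, plus the sum of \<open>(g-mean on R')\<^bsup>q\<^esup> \<omega>(R')\<close>.
The second terms live on disjoint sets; in the third ones, the choice of the family trades
\<open>g\<close> for \<open>f\<close>; and the sum of \<open>(f-mean on R)\<^bsup>p\<^esup>
\<sigma>(R)\<close> over principal cubes is at most a constant times the integral of
\<open>f\<^bsup>p\<^esup>\<sigma>\<close> (Carleson embedding). Young's inequality can take the
place of Hoelder's throughout: a bound for the bilinear form by the sum of the
\<open>p\<close>-th power of the norm of \<open>f\<close> and the \<open>q\<close>-th power of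
the norm of \<open>g\<close> becomes the norm inequality by scaling \<open>g\<close>.

Analysis enters only through a reduction to finite sums. For a finite family of dyadic cubes,
the sets obtained by removing from each cube the smaller cubes of the family are disjoint atoms
on which the operator is constant; the measures of the atoms are weights on the finite forest
formed by the family. Both sides of the equivalence are statements about all finite subfamilies,
by monotone convergence, and for one such family they are the inequalities
\<open>strong_type\<close> and \<open>testing\<close> between finite sums. The lemmas
\<open>one_sided_estimate\<close>, \<open>strong_type_if_testing\<close> and
\<open>dual_testing_if_strong_type\<close> carry the finite part, and
\<open>strong_type_if_Lp_bounded\<close>, \<open>testing_if_Lp_testing\<close> and their
converses the reduction.\<close>

section \<open>Dyadic levels and elementary inequalities\<close>

definition level :: "real \<Rightarrow> int" where
  "level t = \<lfloor>log 2 t\<rfloor>"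

lemma powr_level:
  assumes "0 < t"
  shows "2 powr real_of_int (level t) \<le> t" "t < 2 * 2 powr real_of_int (level t)"
proof -
  have "2 powr real_of_int (level t) \<le> 2 powr log 2 t"
    unfolding level_def by (intro powr_mono) auto
  then show "2 powr real_of_int (level t) \<le> t" using assms by simp
  have "2 powr log 2 t < 2 powr (real_of_int (level t) + 1)"
    unfolding level_def by (intro powr_less_mono) linarith+
  then show "t < 2 * 2 powr real_of_int (level t)" using assms by (simp add: powr_add)
qed

lemma level_mono: "0 < s \<Longrightarrow> s \<le> t \<Longrightarrow> level s \<le> level t"
  unfolding level_def by (intro floor_mono) simp

lemma level_eq_imp_le:
  assumes "0 < s" "0 < t" "level s = level t"
  shows "s \<le> 2 * t"
  using powr_level(2)[OF assms(1)] powr_level(1)[OF assms(2)] assms(3) by simp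

text \<open>The factor \<open>2 powr s\<close> is the loss in replacing a number by the power of
two just below it; the rest is the sum of a geometric series of ratio \<open>2 powr (-
s)\<close>.\<close>

definition geom_const :: "real \<Rightarrow> real" where
  "geom_const s = 2 powr s / (1 - 2 powr (- s))"

lemma geom_const_nonneg: "0 < s \<Longrightarrow> 0 \<le> geom_const s"
  unfolding geom_const_def by (simp add: powr_minus divide_simps)

text \<open>With at most one number in each interval \<open>[2\<^sup>k,
2\<^bsup>k+1\<^esup>)\<close>, the powers decay geometrically downwards from the level of
\<open>T\<close>. Means along a chain of principal cubes are of this kind.\<close>

lemma sum_powr_distinct_levels:
  assumes "finite A" "0 < s" "0 < T" and E: "\<And>x. x \<in> A \<Longrightarrow> 0 < E x \<and> E x \<le> T"
    and inj: "inj_on (\<lambda>x. level (E x)) A"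
  shows "(\<Sum>x\<in>A. E x powr s) \<le> geom_const s * T powr s"
proof -
  define r where "r = 2 powr (- s)"
  have r: "0 < r" "r < 1" using \<open>0 < s\<close> by (auto simp: r_def powr_minus divide_simps)
  \<comment> \<open>number of levels that separate \<open>E x\<close> from the top\<close>
  define j where "j x = nat (level T - level (E x))" for x
  have lev: "level (E x) \<le> level T" if "x \<in> A" for x
    using E[OF that] level_mono by blast
  have "E x powr s \<le> 2 powr s * T powr s * r ^ j x" if "x \<in> A" for x
  proof -
    have "E x powr s \<le> (2 * 2 powr real_of_int (level (E x))) powr s"
      using E[OF that] powr_level(2)[of "E x"] \<open>0 < s\<close> by (intro powr_mono2) auto
    also have "\<dots> = 2 powr s * (2 powr real_of_int (level T)) powr s * r ^ j x"
      using lev[OF that] r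
      by (simp add: powr_mult powr_powr j_def r_def powr_add[symmetric] algebra_simps
          flip: powr_realpow)
    also have "\<dots> \<le> 2 powr s * T powr s * r ^ j x"
      using powr_level(1)[OF \<open>0 < T\<close>] \<open>0 < s\<close> r
      by (intro mult_right_mono mult_left_mono powr_mono2) auto
    finally show ?thesis .
  qed
  then have "(\<Sum>x\<in>A. E x powr s) \<le> (\<Sum>x\<in>A. 2 powr s * T powr s * r ^ j x)"
    by (rule sum_mono)
  also have "\<dots> = 2 powr s * T powr s * (\<Sum>x\<in>A. r ^ j x)"
    by (simp add: sum_distrib_left)
  also have "(\<Sum>x\<in>A. r ^ j x) = (\<Sum>i\<in>j ` A. r ^ i)"
  proof -
    have "inj_on j A"
    proof (rule inj_onI)
      fix x y assume xy: "x \<in> A" "y \<in> A" "j x = j y"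
      then have "level (E x) = level (E y)" using lev[of x] lev[of y] by (auto simp: j_def)
      then show "x = y" using inj xy by (auto dest: inj_onD)
    qed
    then show ?thesis by (simp add: sum.reindex)
  qed
  also have "(\<Sum>i\<in>j ` A. r ^ i) \<le> 1 / (1 - r)"
    using sum_le_suminf[of "\<lambda>i. r ^ i" "j ` A"] r \<open>finite A\<close>
    by (simp add: suminf_geometric summable_geometric)
  finally have "(\<Sum>x\<in>A. E x powr s) \<le> 2 powr s * T powr s * (1 / (1 - r))"
    by (simp add: mult_left_mono)
  then show ?thesis by (simp add: geom_const_def r_def mult_ac)
qed

lemma Young_unweighted:
  fixes p q :: real
  assumes "1 < p" "1 / p + 1 / q = 1" "0 \<le> a" "0 \<le> b"
  shows "a * b \<le> a powr p + b powr q"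
proof -
  have "1 < q"
  proof -
    have "1 / q = 1 - 1 / p" using assms(2) by simp
    then have "0 < 1 / q" "1 / q < 1" using assms(1) by auto
    then show ?thesis by (simp add: divide_simps split: if_splits)
  qed
  then have "a * b \<le> a powr p / p + b powr q / q"
    using assms by (intro Youngs_inequality) auto
  also have "\<dots> \<le> a powr p + b powr q"
    using assms \<open>1 < q\<close> by (intro add_mono) (auto simp: divide_simps mult_le_cancel_left1)
  finally show ?thesis .
qed

lemma sum_disjoint_family_le:
  fixes h :: "'b \<Rightarrow> real"
  assumes "finite A" "finite X" "\<And>a. a \<in> A \<Longrightarrow> B a \<subseteq> X" "\<And>x. x \<in> X \<Longrightarrow> 0 \<le> h x"
    and "\<And>a b. a \<in> A \<Longrightarrow> b \<in> A \<Longrightarrow> a \<noteq> b \<Longrightarrow> B a \<inter> B b = {}"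
  shows "(\<Sum>a\<in>A. sum h (B a)) \<le> sum h X"
proof -
  have "(\<Sum>a\<in>A. sum h (B a)) = sum h (\<Union>a\<in>A. B a)"
    using assms by (intro sum.UNION_disjoint[symmetric]) (auto intro: finite_subset)
  also have "\<dots> \<le> sum h X" using assms by (intro sum_mono2) auto
  finally show ?thesis .
qed

lemma sum_UNION_le:
  fixes h :: "'b \<Rightarrow> real"
  assumes "finite A" "\<And>a. a \<in> A \<Longrightarrow> finite (B a)" "X \<subseteq> (\<Union>a\<in>A. B a)"
    and "\<And>a x. a \<in> A \<Longrightarrow> x \<in> B a \<Longrightarrow> 0 \<le> h x"
  shows "sum h X \<le> (\<Sum>a\<in>A. sum h (B a))"
proof -
  have "sum h X \<le> sum h (\<Union>a\<in>A. B a)"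
    using assms by (intro sum_mono2) auto
  also have "\<dots> \<le> (\<Sum>a\<in>A. sum h (B a))"
    using assms(1,2,4)
  proof (induction A)
    case (insert a A)
    have "sum h (B a \<union> (\<Union>a\<in>A. B a)) \<le> sum h (B a) + sum h (\<Union>a\<in>A. B a)"
      using insert by (subst sum_Un) (auto intro!: sum_nonneg)
    moreover have "sum h (\<Union>a\<in>A. B a) \<le> (\<Sum>a\<in>A. sum h (B a))"
      using insert.prems by (intro insert.IH) auto
    ultimately show ?case using insert.hyps by simp
  qed simp
  finally show ?thesis .
qed

section \<open>Finite weighted forests and the Carleson embedding\<close>

definition carleson_const :: "real \<Rightarrow> real" where
  "carleson_const p = 2 powr p * geom_const (p - 1)"

lemma carleson_const_nonneg: "1 < p \<Longrightarrow> 0 \<le> carleson_const p"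
  by (simp add: carleson_const_def geom_const_nonneg)

text \<open>The model is a finite family of dyadic cubes ordered by inclusion. Its members serve
twice: as cubes, and as indices of disjoint atoms, a cube \<open>Q\<close> being the union of
the atoms of all \<open>P \<le> Q\<close>. A weight \<open>w\<close> gives the measure of each
atom, so that \<open>mass w Q\<close> is the measure of the cube \<open>Q\<close>, and a
function \<open>f\<close> on the forest stands for a function constant on atoms.\<close>

locale finite_forest =
  fixes I :: "'a::order set"
  assumes finite_I: "finite I"
    and comparable: "\<And>P Q Q'. P \<in> I \<Longrightarrow> Q \<in> I \<Longrightarrow> Q' \<in> I \<Longrightarrow> P \<le> Q \<Longrightarrow> P \<le> Q' \<Longrightarrow>
      Q \<le> Q' \<or> Q' \<le> Q"
begin

definition below :: "'a \<Rightarrow> 'a set" where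
  "below Q = {P \<in> I. P \<le> Q}"

definition mass :: "('a \<Rightarrow> real) \<Rightarrow> 'a \<Rightarrow> real" where
  "mass w Q = sum w (below Q)"

definition mean :: "('a \<Rightarrow> real) \<Rightarrow> ('a \<Rightarrow> real) \<Rightarrow> 'a \<Rightarrow> real" where
  "mean w f Q = mass (\<lambda>P. f P * w P) Q / mass w Q"

lemma finite_below [simp]: "finite (below Q)"
  using finite_I by (simp add: below_def)

lemma below_subset: "below Q \<subseteq> I"
  by (auto simp: below_def)

lemma mass_nonneg: "(\<And>P. P \<in> I \<Longrightarrow> 0 \<le> w P) \<Longrightarrow> 0 \<le> mass w Q"
  by (auto simp: mass_def below_def intro!: sum_nonneg)

lemma mean_nonneg:
  "(\<And>P. P \<in> I \<Longrightarrow> 0 \<le> w P) \<Longrightarrow> (\<And>P. P \<in> I \<Longrightarrow> 0 \<le> f P) \<Longrightarrow> 0 \<le> mean w f Q"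
  by (auto simp: mean_def intro!: divide_nonneg_nonneg mass_nonneg)

text \<open>This includes the case of a cube of mass 0, where the mean is 0 by the convention
for division, and all its atoms have weight 0.\<close>

lemma mean_times_mass:
  assumes "\<And>P. P \<in> I \<Longrightarrow> 0 \<le> w P"
  shows "mean w f Q * mass w Q = mass (\<lambda>P. f P * w P) Q"
proof (cases "mass w Q = 0")
  case True
  then have "\<forall>P\<in>below Q. w P = 0"
    using assms below_subset by (subst (asm) mass_def, subst (asm) sum_nonneg_eq_0_iff) auto
  then show ?thesis using True by (simp add: mass_def)
qed (simp add: mean_def)

text \<open>At least half of the integral of \<open>f\<close> over \<open>R\<close> comes from
the points where \<open>f\<close> exceeds half of its average \<open>E\<close> over
\<open>R\<close>. Hence \<open>E\<^bsup>p\<^esup> w(R)\<close> is at most the integral of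
\<open>2 E\<^bsup>p-1\<^esup> f w\<close> over these points. For a fixed point, the members of
\<open>J\<close> above it form a chain with distinct levels, and the means that enter are below
\<open>2 f\<close>; so the sum over \<open>J\<close> is a geometric sum bounded by a multiple of
\<open>f\<^bsup>p-1\<^esup> f\<close>.\<close>

lemma carleson_embedding:
  assumes p: "1 < p"
    and w: "\<And>P. P \<in> I \<Longrightarrow> 0 \<le> w P" and f: "\<And>P. P \<in> I \<Longrightarrow> 0 \<le> f P"
    and J: "J \<subseteq> I" and pos: "\<And>R. R \<in> J \<Longrightarrow> 0 < mean w f R"
    and distinct_levels: "\<And>R R'. R \<in> J \<Longrightarrow> R' \<in> J \<Longrightarrow> R < R' \<Longrightarrow>
      level (mean w f R) \<noteq> level (mean w f R')"
  shows "(\<Sum>R\<in>J. mean w f R powr p * mass w R) \<le> carleson_const p * (\<Sum>P\<in>I. f P powr p * w P)"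
proof -
  define E where "E = mean w f"
  have finJ: "finite J" using J finite_I finite_subset by blast
  \<comment> \<open>the contribution of the atom \<open>P\<close> to the truncated bound for \<open>R\<close>\<close>
  define h where "h R P = (if E R < 2 * f P then 2 * (f P * w P) * E R powr (p - 1) else 0)" for R P
  have "E R powr p * mass w R \<le> (\<Sum>P\<in>below R. h R P)" if R: "R \<in> J" for R
  proof -
    have "E R * mass w R = (\<Sum>P\<in>below R. f P * w P)"
      using mean_times_mass[OF w] by (simp add: E_def mass_def)
    also have "\<dots> \<le> (\<Sum>P\<in>below R. (if E R < 2 * f P then f P * w P else 0) + E R / 2 * w P)"
    proof (rule sum_mono)
      fix P assume "P \<in> below R"
      then have "P \<in> I" using below_subset by blast
      show "f P * w P \<le> (if E R < 2 * f P then f P * w P else 0) + E R / 2 * w P"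
        using w[OF \<open>P \<in> I\<close>] pos[OF R] mult_right_mono[of "f P" "E R / 2" "w P"]
        by (auto simp: E_def)
    qed
    also have "\<dots> = (\<Sum>P\<in>below R. if E R < 2 * f P then f P * w P else 0) + E R / 2 * mass w R"
      by (simp add: sum.distrib mass_def sum_distrib_left)
    finally have "E R * mass w R \<le> 2 * (\<Sum>P\<in>below R. if E R < 2 * f P then f P * w P else 0)"
      by simp
    then have "E R powr (p - 1) * (E R * mass w R)
        \<le> E R powr (p - 1) * (2 * (\<Sum>P\<in>below R. if E R < 2 * f P then f P * w P else 0))"
      by (intro mult_left_mono) auto
    also have "\<dots> = (\<Sum>P\<in>below R. h R P)"
      by (auto simp: h_def sum_distrib_left intro!: sum.cong)
    also have "E R powr (p - 1) * (E R * mass w R) = E R powr p * mass w R"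
      using pos[OF R] powr_add[of "E R" "p - 1" 1] by (simp add: E_def)
    finally show ?thesis .
  qed
  then have "(\<Sum>R\<in>J. E R powr p * mass w R) \<le> (\<Sum>R\<in>J. \<Sum>P | P \<in> I \<and> P \<le> R. h R P)"
    by (intro sum_mono) (simp add: below_def)
  also have "\<dots> = (\<Sum>P\<in>I. \<Sum>R | R \<in> J \<and> P \<le> R. h R P)"
    using finJ finite_I by (intro sum.swap_restrict)
  also have "\<dots> \<le> (\<Sum>P\<in>I. carleson_const p * (f P powr p * w P))"
  proof (rule sum_mono)
    fix P assume P: "P \<in> I"
    define A where "A = {R \<in> J. P \<le> R \<and> E R < 2 * f P}"
    have "(\<Sum>R | R \<in> J \<and> P \<le> R. h R P) = (\<Sum>R\<in>A. 2 * (f P * w P) * E R powr (p - 1))"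
      unfolding h_def A_def using finJ
      by (subst sum.inter_filter[symmetric]) (auto intro!: sum.cong)
    also have "\<dots> = 2 * (f P * w P) * (\<Sum>R\<in>A. E R powr (p - 1))"
      by (simp add: sum_distrib_left)
    also have "\<dots> \<le> 2 * (f P * w P) * (geom_const (p - 1) * (2 * f P) powr (p - 1))"
    proof (cases "f P = 0")
      case False
      with f[OF P] have fP: "0 < f P" by simp
      have "inj_on (\<lambda>R. level (E R)) A"
      proof (rule inj_onI)
        fix R R' assume RR: "R \<in> A" "R' \<in> A" "level (E R) = level (E R')"
        then have "R \<le> R' \<or> R' \<le> R"
          using comparable[of P R R'] P J by (auto simp: A_def)
        then show "R = R'"
          using RR distinct_levels[of R R'] distinct_levels[of R' R]
          by (auto simp: A_def E_def order.order_iff_strict)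
      qed
      moreover have "finite A" using finJ by (simp add: A_def)
      ultimately have "(\<Sum>R\<in>A. E R powr (p - 1)) \<le> geom_const (p - 1) * (2 * f P) powr (p - 1)"
        using p fP pos by (intro sum_powr_distinct_levels) (auto simp: A_def E_def)
      then show ?thesis using f[OF P] w[OF P] by (intro mult_left_mono) auto
    qed simp
    also have "\<dots> = carleson_const p * (f P powr p * w P)"
    proof (cases "f P = 0")
      case False
      with f[OF P] have "0 < f P" by simp
      then have "f P * (2 * f P) powr (p - 1) = 2 powr (p - 1) * f P powr p"
        using powr_add[of "f P" "p - 1" 1] by (simp add: powr_mult)
      moreover have "2 * 2 powr (p - 1) = 2 powr p"
        using powr_add[of 2 "p - 1" 1] by simp
      ultimately show ?thesis
        by (simp add: carleson_const_def)
    qed (use p in simp)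
    finally show "(\<Sum>R | R \<in> J \<and> P \<le> R. h R P) \<le> carleson_const p * (f P powr p * w P)" .
  qed
  finally show ?thesis by (simp add: E_def sum_distrib_left)
qed

text \<open>The testing condition for the operator that maps \<open>f\<close> to \<open>P
\<mapsto> (\<Sum>Q \<ge> P. a Q * mass (f m) Q)\<close>, applied to the function 1 and localized
to \<open>R\<close>. The number \<open>D\<close> corresponds to the \<open>p\<close>-th power of
a constant in the norm inequality.\<close>

definition testing ::
  "real \<Rightarrow> ('a \<Rightarrow> real) \<Rightarrow> ('a \<Rightarrow> real) \<Rightarrow> ('a \<Rightarrow> real) \<Rightarrow> real \<Rightarrow> bool" where
  "testing p a m n D \<longleftrightarrow>
     (\<forall>R\<in>I. (\<Sum>P\<in>below R. (\<Sum>Q | Q \<in> I \<and> P \<le> Q \<and> Q \<le> R. a Q * mass m Q) powr p * n P)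
       \<le> D * mass m R)"


lemma testing_mono:
  assumes "testing p a m n D" "D \<le> D'" "\<And>P. P \<in> I \<Longrightarrow> 0 \<le> m P"
  shows "testing p a m n D'"
  unfolding testing_def
proof
  fix R assume "R \<in> I"
  then have "(\<Sum>P\<in>below R. (\<Sum>Q | Q \<in> I \<and> P \<le> Q \<and> Q \<le> R. a Q * mass m Q) powr p * n P) \<le> D * mass m R"
    using assms(1) by (simp add: testing_def)
  also have "\<dots> \<le> D' * mass m R"
    using assms(2,3) by (intro mult_right_mono mass_nonneg)
  finally show "(\<Sum>P\<in>below R. (\<Sum>Q | Q \<in> I \<and> P \<le> Q \<and> Q \<le> R. a Q * mass m Q) powr p * n P) \<le> D' * mass m R" .
qed

section \<open>The bilinear form on a finite forest\<close>

lemma strictly_comparable: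
  assumes "P \<in> I" "Q \<in> I" "Q' \<in> I" "P \<le> Q" "P \<le> Q'" "Q \<noteq> Q'"
  shows "Q < Q' \<or> Q' < Q"
  using comparable[OF assms(1-5)] assms(6) by (auto simp: order.strict_iff_order)

text \<open>The part of the bilinear form that belongs to one principal cube \<open>R\<close>.
Here \<open>G\<close> is the group of \<open>R\<close>, \<open>C\<close> the set of principal
cubes next below \<open>R\<close>, \<open>X\<close> the set of atoms of \<open>R\<close> outside
the members of \<open>C\<close>, and \<open>e\<close> the mean of \<open>f\<close> on
\<open>R\<close>. Since a cube of \<open>G\<close> contains every member of \<open>C\<close>
that it meets, only the integrals of \<open>g\<close> over members of \<open>C\<close> matter,
and \<open>g\<close> may be replaced there by its means. The function \<open>u\<close> in the
proof is the operator restricted to \<open>G\<close> and applied to 1; it is paired with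
\<open>g\<close> by Young's inequality, and its \<open>p\<close>-th power is controlled by
testing at \<open>R\<close>.\<close>

lemma principal_estimate:
  assumes p: "1 < p" "1 / p + 1 / q = 1"
    and m: "\<And>P. P \<in> I \<Longrightarrow> 0 \<le> m P" and n: "\<And>P. P \<in> I \<Longrightarrow> 0 \<le> n P"
    and g: "\<And>P. P \<in> I \<Longrightarrow> 0 \<le> g P" and a: "\<And>Q. Q \<in> I \<Longrightarrow> 0 \<le> a Q"
    and testing: "testing p a m n D"
    and R: "R \<in> I" and G: "G \<subseteq> below R" and C: "finite C" "C \<subseteq> below R"
    and X: "X \<subseteq> below R" "\<And>R'. R' \<in> C \<Longrightarrow> X \<inter> below R' = {}"
    and disj: "\<And>R' R''. R' \<in> C \<Longrightarrow> R'' \<in> C \<Longrightarrow> R' \<noteq> R'' \<Longrightarrow> below R' \<inter> below R'' = {}"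
    and cover: "\<And>Q P. Q \<in> G \<Longrightarrow> P \<in> below Q \<Longrightarrow> P \<in> X \<or> (\<exists>R'\<in>C. P \<le> R' \<and> R' \<le> Q)"
    and e: "0 \<le> e"
  shows "e * (\<Sum>Q\<in>G. a Q * mass m Q * mass (\<lambda>P. g P * n P) Q)
    \<le> D * (e powr p * mass m R) + (\<Sum>P\<in>X. g P powr q * n P)
       + (\<Sum>R'\<in>C. mean n g R' powr q * mass n R')"
proof -
  define b where "b Q = a Q * mass m Q" for Q
  have GI: "G \<subseteq> I" and CI: "C \<subseteq> I" and XI: "X \<subseteq> I" and finG: "finite G" and finX: "finite X"
    using G C X below_subset finite_subset[OF _ finite_below] by blast+
  have b: "0 \<le> b Q" if "Q \<in> G" for Q
    using that a GI m by (auto simp: b_def intro!: mult_nonneg_nonneg mass_nonneg)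
  define u where "u P = (\<Sum>Q | Q \<in> G \<and> P \<le> Q. b Q)" for P
  have u: "0 \<le> u P" for P using b by (auto simp: u_def intro!: sum_nonneg)
  define gn where "gn P = g P * n P" for P
  have gn: "0 \<le> gn P" if "P \<in> I" for P using that g n by (simp add: gn_def)
  have mass_le: "mass gn Q \<le> (\<Sum>P | P \<in> X \<and> P \<le> Q. gn P) + (\<Sum>R' | R' \<in> C \<and> R' \<le> Q. mass gn R')"
    if Q: "Q \<in> G" for Q
  proof -
    have "mass gn Q \<le> sum gn ({P \<in> X. P \<le> Q} \<union> (below Q - X))"
      unfolding mass_def using finX XI gn
      by (intro sum_mono2) (auto simp: below_def finite_I)
    also have "\<dots> = (\<Sum>P | P \<in> X \<and> P \<le> Q. gn P) + sum gn (below Q - X)"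
      using finX by (intro sum.union_disjoint) auto
    also have "sum gn (below Q - X) \<le> (\<Sum>R' | R' \<in> C \<and> R' \<le> Q. sum gn (below R'))"
    proof (rule sum_UNION_le)
      show "below Q - X \<subseteq> (\<Union>R'\<in>{R' \<in> C. R' \<le> Q}. below R')"
        using cover[OF Q] by (auto simp: below_def)
    qed (use C(1) gn in \<open>auto simp: below_def finite_I\<close>)
    finally show ?thesis by (simp add: mass_def)
  qed
  have "(\<Sum>Q\<in>G. b Q * mass gn Q)
      \<le> (\<Sum>Q\<in>G. b Q * ((\<Sum>P | P \<in> X \<and> P \<le> Q. gn P) + (\<Sum>R' | R' \<in> C \<and> R' \<le> Q. mass gn R')))"
    using mass_le b by (intro sum_mono mult_left_mono)
  also have "\<dots> = (\<Sum>Q\<in>G. \<Sum>P | P \<in> X \<and> P \<le> Q. b Q * gn P)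
      + (\<Sum>Q\<in>G. \<Sum>R' | R' \<in> C \<and> R' \<le> Q. b Q * mass gn R')"
    by (simp add: sum.distrib distrib_left sum_distrib_left)
  also have "(\<Sum>Q\<in>G. \<Sum>P | P \<in> X \<and> P \<le> Q. b Q * gn P) = (\<Sum>P\<in>X. u P * gn P)"
    unfolding u_def sum_distrib_right using finG finX by (rule sum.swap_restrict)
  also have "(\<Sum>Q\<in>G. \<Sum>R' | R' \<in> C \<and> R' \<le> Q. b Q * mass gn R') = (\<Sum>R'\<in>C. u R' * mass gn R')"
    unfolding u_def sum_distrib_right using finG C(1) by (rule sum.swap_restrict)
  finally have "e * (\<Sum>Q\<in>G. b Q * mass gn Q)
      \<le> e * ((\<Sum>P\<in>X. u P * gn P) + (\<Sum>R'\<in>C. u R' * mass gn R'))"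
    using e by (intro mult_left_mono)
  also have "\<dots> = (\<Sum>P\<in>X. (e * u P) * g P * n P) + (\<Sum>R'\<in>C. (e * u R') * mean n g R' * mass n R')"
    using mean_times_mass[OF n, where f = g]
    by (simp add: distrib_left sum_distrib_left gn_def[abs_def] mult.assoc)
  also have "\<dots> \<le> (\<Sum>P\<in>X. (e * u P) powr p * n P + g P powr q * n P)
      + (\<Sum>R'\<in>C. (\<Sum>P\<in>below R'. (e * u P) powr p * n P) + mean n g R' powr q * mass n R')"
  proof (intro add_mono sum_mono)
    fix P assume "P \<in> X"
    then have "P \<in> I" using XI by blast
    have "(e * u P) * g P \<le> (e * u P) powr p + g P powr q"
      using p e u g[OF \<open>P \<in> I\<close>] by (intro Young_unweighted) auto
    then show "(e * u P) * g P * n P \<le> (e * u P) powr p * n P + g P powr q * n P"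
      using mult_right_mono[OF _ n[OF \<open>P \<in> I\<close>]] by (simp add: distrib_right[symmetric])
  next
    fix R' assume "R' \<in> C"
    have "(e * u R') * mean n g R' \<le> (e * u R') powr p + mean n g R' powr q"
      using p e u mean_nonneg[of n g] n g by (intro Young_unweighted) auto
    then have "(e * u R') * mean n g R' * mass n R'
        \<le> ((e * u R') powr p + mean n g R' powr q) * mass n R'"
      using mass_nonneg[of n] n by (intro mult_right_mono) auto
    also have "\<dots> = (\<Sum>P\<in>below R'. (e * u R') powr p * n P) + mean n g R' powr q * mass n R'"
      by (simp add: distrib_right mass_def sum_distrib_left sum.distrib)
    also have "\<dots> \<le> (\<Sum>P\<in>below R'. (e * u P) powr p * n P) + mean n g R' powr q * mass n R'"
    proof (intro add_right_mono sum_mono mult_right_mono powr_mono2 mult_left_mono)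
      fix P assume P: "P \<in> below R'"
      then show "0 \<le> n P" using n below_subset by blast
      \<comment> \<open>\<open>P\<close> lies below \<open>R'\<close>, so it is contained in more cubes of the group\<close>
      show "u R' \<le> u P"
        unfolding u_def using P finG b by (intro sum_mono2) (auto simp: below_def)
    qed (use p e u in auto)
    finally show "(e * u R') * mean n g R' * mass n R'
        \<le> (\<Sum>P\<in>below R'. (e * u P) powr p * n P) + mean n g R' powr q * mass n R'" .
  qed
  also have "\<dots> = ((\<Sum>P\<in>X. (e * u P) powr p * n P)
        + (\<Sum>R'\<in>C. \<Sum>P\<in>below R'. (e * u P) powr p * n P))
      + (\<Sum>P\<in>X. g P powr q * n P) + (\<Sum>R'\<in>C. mean n g R' powr q * mass n R')"
    by (simp add: sum.distrib)
  also have "(\<Sum>P\<in>X. (e * u P) powr p * n P) + (\<Sum>R'\<in>C. \<Sum>P\<in>below R'. (e * u P) powr p * n P)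
      \<le> D * (e powr p * mass m R)"
  proof -
    have "(\<Sum>R'\<in>C. \<Sum>P\<in>below R'. (e * u P) powr p * n P)
        \<le> (\<Sum>P\<in>below R - X. (e * u P) powr p * n P)"
    proof (intro sum_disjoint_family_le)
      show "below R' \<subseteq> below R - X" if "R' \<in> C" for R'
        using that C(2) X(2)[OF that] by (auto simp: below_def)
      show "0 \<le> (e * u P) powr p * n P" if "P \<in> below R - X" for P
        using that n below_subset by (intro mult_nonneg_nonneg) auto
    qed (use C disj in auto)
    then have "(\<Sum>P\<in>X. (e * u P) powr p * n P) + (\<Sum>R'\<in>C. \<Sum>P\<in>below R'. (e * u P) powr p * n P)
        \<le> (\<Sum>P\<in>below R. (e * u P) powr p * n P)"
      using sum.subset_diff[OF X(1) finite_below, of "\<lambda>P. (e * u P) powr p * n P"] by linarith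
    also have "\<dots> = e powr p * (\<Sum>P\<in>below R. u P powr p * n P)"
      using e u by (simp add: powr_mult sum_distrib_left mult.assoc)
    also have "\<dots> \<le> e powr p *
        (\<Sum>P\<in>below R. (\<Sum>Q | Q \<in> I \<and> P \<le> Q \<and> Q \<le> R. a Q * mass m Q) powr p * n P)"
    proof (intro mult_left_mono sum_mono mult_right_mono powr_mono2)
      fix P assume P: "P \<in> below R"
      then show "0 \<le> n P" using n below_subset by blast
      show "u P \<le> (\<Sum>Q | Q \<in> I \<and> P \<le> Q \<and> Q \<le> R. a Q * mass m Q)"
        unfolding u_def b_def using G finite_I a m
        by (intro sum_mono2) (auto simp: below_def intro!: mult_nonneg_nonneg mass_nonneg)
    qed (use p u in auto)
    also have "\<dots> \<le> e powr p * (D * mass m R)"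
      using testing R by (intro mult_left_mono) (auto simp: testing_def)
    finally show ?thesis by (simp add: mult_ac)
  qed
  finally show ?thesis by (simp add: b_def gn_def[abs_def])
qed

text \<open>Principal cubes are obtained without recursion: \<open>M Q\<close> is the largest
mean of \<open>f\<close> over a cube of \<open>J\<close> containing \<open>Q\<close>, which
increases as \<open>Q\<close> shrinks, and a cube is principal if its level \<open>L\<close>
exceeds that of all strictly larger ones. The mean of \<open>f\<close> over a principal cube
\<open>R\<close> is then \<open>M R\<close> itself, and all cubes of the same level
\<open>L\<close> inside \<open>R\<close> have at most twice this mean. Distinct principal cubes
in a chain have distinct levels, as the Carleson embedding requires.\<close>

lemma one_sided_estimate:
  assumes p: "1 < p" "1 / p + 1 / q = 1"
    and m: "\<And>P. P \<in> I \<Longrightarrow> 0 \<le> m P" and n: "\<And>P. P \<in> I \<Longrightarrow> 0 \<le> n P"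
    and f: "\<And>P. P \<in> I \<Longrightarrow> 0 \<le> f P" and g: "\<And>P. P \<in> I \<Longrightarrow> 0 \<le> g P"
    and a: "\<And>Q. Q \<in> I \<Longrightarrow> 0 \<le> a Q"
    and testing: "testing p a m n D" and D: "0 \<le> D"
    and J: "J \<subseteq> I" and pos: "\<And>Q. Q \<in> J \<Longrightarrow> 0 < mean m f Q"
    and dominant: "\<And>Q. Q \<in> J \<Longrightarrow> mean n g Q powr q * mass n Q \<le> mean m f Q powr p * mass m Q"
  shows "(\<Sum>Q\<in>J. a Q * mass (\<lambda>P. f P * m P) Q * mass (\<lambda>P. g P * n P) Q)
    \<le> 2 * (D + 1) * carleson_const p * (\<Sum>P\<in>I. f P powr p * m P)
       + 2 * (\<Sum>P\<in>I. g P powr q * n P)"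
proof -
  define E where "E = mean m f"
  have finJ: "finite J" using J finite_I finite_subset by blast
  define M where "M Q = Max (E ` {Q' \<in> J. Q \<le> Q'})" for Q
  define L where "L Q = level (M Q)" for Q
  have E_le_M: "E Q' \<le> M Q" if "Q' \<in> J" "Q \<le> Q'" for Q Q'
    using that finJ by (auto simp: M_def)
  have M_pos: "0 < M Q" if "Q \<in> J" for Q
    using E_le_M[of Q Q] pos[OF that] that by (simp add: E_def)
  have L_antimono: "L Q' \<le> L Q" if "Q \<in> J" "Q' \<in> J" "Q \<le> Q'" for Q Q'
  proof -
    have "M Q' \<le> M Q"
      unfolding M_def using that finJ by (intro Max_mono) auto
    then show ?thesis unfolding L_def using M_pos that by (intro level_mono)
  qed
  define F where "F = {R \<in> J. \<forall>Q\<in>J. R < Q \<longrightarrow> L Q < L R}"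
  have FJ: "F \<subseteq> J" by (auto simp: F_def)
  have FI: "F \<subseteq> I" using FJ J by blast
  have finF: "finite F" using FJ finJ finite_subset by blast
  have M_F: "M R = E R" if R: "R \<in> F" for R
  proof -
    have "M R \<in> E ` {Q' \<in> J. R \<le> Q'}"
      unfolding M_def using finJ R FJ by (intro Max_in) auto
    then obtain Q' where Q': "Q' \<in> J" "R \<le> Q'" "M R = E Q'" by auto
    \<comment> \<open>a strictly larger cube attaining the maximum would have the same level as \<open>R\<close>\<close>
    have "Q' = R"
    proof (rule ccontr)
      assume "Q' \<noteq> R"
      then have "L Q' < L R" using Q' R by (auto simp: F_def)
      moreover have "L R \<le> L Q'"
        unfolding L_def using Q' E_le_M[of Q' Q'] pos[of Q'] by (intro level_mono) (auto simp: E_def)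
      ultimately show False by simp
    qed
    then show ?thesis using Q' by simp
  qed
  define G where "G R = {Q \<in> J. Q \<le> R \<and> L Q = L R}" for R
  have J_cover: "J \<subseteq> (\<Union>R\<in>F. G R)"
  proof
    fix Q assume Q: "Q \<in> J"
    have "finite {R \<in> J. Q \<le> R \<and> L R = L Q}" using finJ by simp
    from finite_has_maximal2[OF this, of Q] Q obtain R
      where R: "R \<in> J" "Q \<le> R" "L R = L Q"
        and maximal: "\<And>R'. R' \<in> J \<Longrightarrow> Q \<le> R' \<Longrightarrow> L R' = L Q \<Longrightarrow> R \<le> R' \<Longrightarrow> R = R'"
      by auto
    have "R \<in> F"
      unfolding F_def
    proof (intro CollectI conjI ballI impI)
      fix Q' assume Q': "Q' \<in> J" "R < Q'"
      then have "L Q' \<le> L R" using L_antimono R(1) by simp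
      moreover have "L Q' \<noteq> L R"
        using maximal[OF Q'(1)] Q'(2) R(2,3) by (metis less_le order_trans)
      ultimately show "L Q' < L R" by simp
    qed (use R in auto)
    then show "Q \<in> (\<Union>R\<in>F. G R)" using R Q by (auto simp: G_def)
  qed
  define C where "C R = {R' \<in> F. R' < R \<and> \<not> (\<exists>S\<in>F. R' < S \<and> S < R)}" for R
  define X where "X R = {P \<in> below R. \<not> (\<exists>S\<in>F. S < R \<and> P \<le> S)}" for R
  define gn where "gn P = g P * n P" for P
  have finC: "finite (C R)" for R using finF by (simp add: C_def)
  have group: "(\<Sum>Q\<in>G R. a Q * mass (\<lambda>P. f P * m P) Q * mass gn Q)
      \<le> 2 * (D * (E R powr p * mass m R) + (\<Sum>P\<in>X R. g P powr q * n P)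
         + (\<Sum>R'\<in>C R. mean n g R' powr q * mass n R'))" if R: "R \<in> F" for R
  proof -
    have "(\<Sum>Q\<in>G R. a Q * mass (\<lambda>P. f P * m P) Q * mass gn Q)
        \<le> (\<Sum>Q\<in>G R. 2 * (E R * (a Q * mass m Q * mass gn Q)))"
    proof (rule sum_mono)
      fix Q assume Q: "Q \<in> G R"
      then have QJ: "Q \<in> J" "L Q = L R" by (auto simp: G_def)
      have "E Q \<le> 2 * E R"
        using level_eq_imp_le[of "M Q" "M R"] E_le_M[of Q Q] M_F[OF R] M_pos QJ R FJ
        by (force simp: L_def)
      then have "E Q * (a Q * mass m Q * mass gn Q) \<le> 2 * E R * (a Q * mass m Q * mass gn Q)"
        using QJ J a m g n by (intro mult_right_mono) (auto simp: gn_def intro!: mult_nonneg_nonneg mass_nonneg)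
      then show "a Q * mass (\<lambda>P. f P * m P) Q * mass gn Q \<le> 2 * (E R * (a Q * mass m Q * mass gn Q))"
        using mean_times_mass[OF m, where f = f and Q = Q, symmetric] by (simp add: E_def mult_ac)
    qed
    also have "\<dots> = 2 * (E R * (\<Sum>Q\<in>G R. a Q * mass m Q * mass gn Q))"
      by (simp add: sum_distrib_left)
    also have "E R * (\<Sum>Q\<in>G R. a Q * mass m Q * mass gn Q)
      \<le> D * (E R powr p * mass m R) + (\<Sum>P\<in>X R. g P powr q * n P)
         + (\<Sum>R'\<in>C R. mean n g R' powr q * mass n R')"
      unfolding gn_def[abs_def]
    proof (rule principal_estimate[OF p m n g a testing])
      show "R \<in> I" using R FI by blast
      show "G R \<subseteq> below R" using J unfolding G_def below_def by blast
      show "finite (C R)" by (rule finC)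
      show "C R \<subseteq> below R" using FI unfolding C_def below_def by (blast intro: less_imp_le)
      show "X R \<subseteq> below R" unfolding X_def by blast
      show "X R \<inter> below R' = {}" if R': "R' \<in> C R" for R'
      proof -
        have "R' \<in> F" "R' < R" using R' unfolding C_def by blast+
        then show ?thesis unfolding X_def below_def by blast
      qed
      show "below R' \<inter> below R'' = {}" if "R' \<in> C R" "R'' \<in> C R" "R' \<noteq> R''" for R' R''
      proof (rule ccontr)
        assume "below R' \<inter> below R'' \<noteq> {}"
        then obtain P where P: "P \<in> I" "P \<le> R'" "P \<le> R''" unfolding below_def by blast
        have RF: "R' \<in> F" "R'' \<in> F" "R' < R" "R'' < R" using that unfolding C_def by blast+
        then have "R' < R'' \<or> R'' < R'"
          using strictly_comparable[of P R' R''] P FI \<open>R' \<noteq> R''\<close> by blast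
        then show False using that(1,2) RF unfolding C_def by blast
      qed
      show "0 \<le> E R" using pos[of R] R FJ by (force simp: E_def)
      fix Q P assume Q: "Q \<in> G R" and P: "P \<in> below Q"
      show "P \<in> X R \<or> (\<exists>R'\<in>C R. P \<le> R' \<and> R' \<le> Q)"
      proof (cases "P \<in> X R")
        case False
        then obtain S0 where S0: "S0 \<in> F" "S0 < R" "P \<le> S0"
          using Q P by (auto simp: X_def G_def below_def)
        have "finite {S \<in> F. S < R \<and> P \<le> S}" using finF by simp
        from finite_has_maximal2[OF this, of S0] S0 obtain S
          where S: "S \<in> F" "S < R" "P \<le> S"
            and maximal: "\<And>S'. S' \<in> F \<Longrightarrow> S' < R \<Longrightarrow> P \<le> S' \<Longrightarrow> S \<le> S' \<Longrightarrow> S = S'"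
          by auto
        have "S \<in> C R"
          using S maximal by (force simp: C_def)
        \<comment> \<open>otherwise \<open>Q\<close> would lie inside \<open>S\<close> and inherit its higher level\<close>
        moreover have "S \<le> Q"
        proof (rule ccontr)
          assume "\<not> S \<le> Q"
          then have "Q \<le> S"
            using comparable[of P S Q] S P Q J FI by (auto simp: below_def G_def)
          then have "L S \<le> L Q" using L_antimono[of Q S] Q S FJ by (auto simp: G_def)
          moreover have "L R < L S" using S R FJ by (auto simp: F_def)
          ultimately show False using Q by (simp add: G_def)
        qed
        ultimately show ?thesis using S by blast
      qed simp
    qed
    finally show ?thesis by simp
  qed
  have "(\<Sum>Q\<in>J. a Q * mass (\<lambda>P. f P * m P) Q * mass gn Q)
      \<le> (\<Sum>R\<in>F. \<Sum>Q\<in>G R. a Q * mass (\<lambda>P. f P * m P) Q * mass gn Q)"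
    using J_cover finF finJ J a f m g n
    by (intro sum_UNION_le) (auto simp: G_def gn_def intro!: mult_nonneg_nonneg mass_nonneg)
  also have "\<dots> \<le> (\<Sum>R\<in>F. 2 * (D * (E R powr p * mass m R) + (\<Sum>P\<in>X R. g P powr q * n P)
         + (\<Sum>R'\<in>C R. mean n g R' powr q * mass n R')))"
    using group by (rule sum_mono)
  also have "\<dots> = 2 * (D * (\<Sum>R\<in>F. E R powr p * mass m R)
      + (\<Sum>R\<in>F. \<Sum>P\<in>X R. g P powr q * n P)
      + (\<Sum>R\<in>F. \<Sum>R'\<in>C R. mean n g R' powr q * mass n R'))"
    by (simp add: sum.distrib sum_distrib_left)
  also have "(\<Sum>R\<in>F. \<Sum>P\<in>X R. g P powr q * n P) \<le> (\<Sum>P\<in>I. g P powr q * n P)"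
  proof (rule sum_disjoint_family_le)
    fix R R' assume RR: "R \<in> F" "R' \<in> F" "R \<noteq> R'"
    show "X R \<inter> X R' = {}"
    proof (rule ccontr)
      assume "X R \<inter> X R' \<noteq> {}"
      then obtain P where P: "P \<in> X R" "P \<in> X R'" by blast
      then have "P \<in> I" "P \<le> R" "P \<le> R'" by (auto simp: X_def below_def)
      then have "R < R' \<or> R' < R"
        using strictly_comparable[of P R R'] FI RR by blast
      then show False using RR P unfolding X_def below_def by blast
    qed
  qed (use finF finite_I n in \<open>auto simp: X_def below_def\<close>)
  also have "(\<Sum>R\<in>F. \<Sum>R'\<in>C R. mean n g R' powr q * mass n R')
      \<le> (\<Sum>R'\<in>F. mean n g R' powr q * mass n R')"
  proof (rule sum_disjoint_family_le)
    fix R R' assume RR: "R \<in> F" "R' \<in> F" "R \<noteq> R'"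
    show "C R \<inter> C R' = {}"
    proof (rule ccontr)
      assume "C R \<inter> C R' \<noteq> {}"
      then obtain S where S: "S \<in> C R" "S \<in> C R'" by blast
      then have SF: "S \<in> I" "S \<le> R" "S \<le> R'" using FI unfolding C_def by (auto intro: less_imp_le)
      have "R < R' \<or> R' < R"
        using strictly_comparable[OF SF(1) _ _ SF(2,3)] FI RR by blast
      then show False using RR S unfolding C_def by blast
    qed
  qed (use finF n mass_nonneg in \<open>auto simp: C_def\<close>)
  \<comment> \<open>the defining property of \<open>J\<close> converts the means of \<open>g\<close> into means of \<open>f\<close>\<close>
  also have "\<dots> \<le> (\<Sum>R\<in>F. E R powr p * mass m R)"
    using dominant FJ by (intro sum_mono) (auto simp: E_def)
  also have "2 * (D * (\<Sum>R\<in>F. E R powr p * mass m R) + (\<Sum>P\<in>I. g P powr q * n P)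
      + (\<Sum>R\<in>F. E R powr p * mass m R))
    = 2 * (D + 1) * (\<Sum>R\<in>F. E R powr p * mass m R) + 2 * (\<Sum>P\<in>I. g P powr q * n P)"
    by (simp add: algebra_simps)
  also have "(\<Sum>R\<in>F. E R powr p * mass m R) \<le> carleson_const p * (\<Sum>P\<in>I. f P powr p * m P)"
    unfolding E_def
  proof (rule carleson_embedding[OF p(1) m f FI])
    fix R R' assume RR: "R \<in> F" "R' \<in> F" "R < R'"
    then have "L R' < L R" using FJ by (auto simp: F_def)
    then show "level (mean m f R) \<noteq> level (mean m f R')"
      using M_F RR by (simp add: L_def E_def)
  qed (use pos FJ in auto)
  finally show ?thesis
    using D by (simp add: gn_def[abs_def] mult_left_mono mult.assoc)
qed

end

section \<open>Strong type and testing on a finite forest\<close>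

lemma conjugate_exponent:
  fixes p q :: real
  assumes "1 < p" "1 / p + 1 / q = 1"
  shows "1 < q" "(p - 1) * q = p" "(q - 1) * p = q"
proof -
  have "1 / q = (p - 1) / p" using assms by (simp add: field_simps)
  then have q: "q = p / (p - 1)"
    by (metis div_by_1 divide_divide_eq_right mult_1)
  then show "(p - 1) * q = p" using assms(1) by simp
  show "1 < q" using q assms(1) by simp
  show "(q - 1) * p = q" using q assms(1) by (simp add: field_simps)
qed

text \<open>For \<open>t = c powr (- 1 / (q - 1))\<close> this says \<open>c t\<^sup>q =
t\<close>: scaling by \<open>t\<close> in Young's inequality makes a term of degree
\<open>q\<close> small enough, relative to one of degree 1, to be absorbed.\<close>

lemma powr_absorb:
  fixes c q :: real
  assumes "0 < c" "1 < q"
  shows "c * (c powr (- 1 / (q - 1))) powr q = c powr (- 1 / (q - 1))"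
proof -
  have "c * (c powr (- 1 / (q - 1))) powr q = c powr (1 + (- 1 / (q - 1)) * q)"
    using assms by (simp only: powr_powr powr_add powr_one)
  also have "1 + (- 1 / (q - 1)) * q = - 1 / (q - 1)" using assms by (simp add: field_simps)
  finally show ?thesis .
qed

context finite_forest
begin

text \<open>The norm inequality from \<open>L\<^sup>p(m)\<close> to \<open>L\<^sup>p(n)\<close>,
raised to the power \<open>p\<close>, for the operator whose localized testing condition is
\<open>testing\<close>.\<close>

definition strong_type ::
  "real \<Rightarrow> ('a \<Rightarrow> real) \<Rightarrow> ('a \<Rightarrow> real) \<Rightarrow> ('a \<Rightarrow> real) \<Rightarrow> real \<Rightarrow> bool" where
  "strong_type p a m n B \<longleftrightarrow>
     (\<forall>f. (\<forall>P\<in>I. 0 \<le> f P) \<longrightarrow>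
       (\<Sum>P\<in>I. (\<Sum>Q | Q \<in> I \<and> P \<le> Q. a Q * mass (\<lambda>P. f P * m P) Q) powr p * n P)
         \<le> B * (\<Sum>P\<in>I. f P powr p * m P))"

text \<open>The cubes are divided according to which of the two quantities \<open>(mean of
f)\<^sup>p m(Q)\<close> and \<open>(mean of g)\<^sup>q n(Q)\<close> is larger. A cube in neither
\<open>J1\<close> nor \<open>J2\<close> has a vanishing mean, hence does not contribute to the
form. The problem is symmetric under exchanging \<open>(p, m, f)\<close> and \<open>(q, n,
g)\<close>, so both families fall under the one-sided estimate.\<close>

lemma bilinear_estimate:
  assumes p: "1 < p" "1 / p + 1 / q = 1"
    and m: "\<And>P. P \<in> I \<Longrightarrow> 0 \<le> m P" and n: "\<And>P. P \<in> I \<Longrightarrow> 0 \<le> n P"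
    and f: "\<And>P. P \<in> I \<Longrightarrow> 0 \<le> f P" and g: "\<And>P. P \<in> I \<Longrightarrow> 0 \<le> g P"
    and a: "\<And>Q. Q \<in> I \<Longrightarrow> 0 \<le> a Q" and D: "0 \<le> D"
    and testing: "testing p a m n D" "testing q a n m D"
  shows "(\<Sum>Q\<in>I. a Q * mass (\<lambda>P. f P * m P) Q * mass (\<lambda>P. g P * n P) Q)
    \<le> (2 * (D + 1) * (carleson_const p + carleson_const q) + 2) *
      ((\<Sum>P\<in>I. f P powr p * m P) + (\<Sum>P\<in>I. g P powr q * n P))"
proof -
  note q = conjugate_exponent[OF p]
  define t where "t Q = a Q * mass (\<lambda>P. f P * m P) Q * mass (\<lambda>P. g P * n P) Q" for Q
  define Ff where "Ff = (\<Sum>P\<in>I. f P powr p * m P)"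
  define Gg where "Gg = (\<Sum>P\<in>I. g P powr q * n P)"
  have FG: "0 \<le> Ff" "0 \<le> Gg" using m n by (auto simp: Ff_def Gg_def intro!: sum_nonneg)
  define J1 where "J1 = {Q \<in> I. 0 < mean m f Q \<and>
    mean n g Q powr q * mass n Q \<le> mean m f Q powr p * mass m Q}"
  define J2 where "J2 = {Q \<in> I. 0 < mean n g Q \<and>
    mean m f Q powr p * mass m Q \<le> mean n g Q powr q * mass n Q}"
  have t0: "0 \<le> t Q" if "Q \<in> I" for Q
    using that a f g m n by (auto simp: t_def intro!: mult_nonneg_nonneg mass_nonneg)
  have zero: "t Q = 0" if Q: "Q \<in> I" "Q \<notin> J1 \<union> J2" for Q
  proof -
    have "mean m f Q = 0 \<or> mean n g Q = 0"
      using Q mean_nonneg[of m f Q] mean_nonneg[of n g Q] f g m n by (force simp: J1_def J2_def)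
    then show ?thesis
      using mean_times_mass[of m f Q] mean_times_mass[of n g Q] m n
      by (auto simp: t_def)
  qed
  have "sum t I = sum t (J1 \<union> J2)"
    using zero finite_I by (intro sum.mono_neutral_right) (auto simp: J1_def J2_def)
  also have "\<dots> \<le> sum t J1 + sum t J2"
    using finite_I t0 by (subst sum_Un) (auto simp: J1_def J2_def intro!: sum_nonneg)
  also have "sum t J1 \<le> 2 * (D + 1) * carleson_const p * Ff + 2 * Gg"
    unfolding t_def Ff_def Gg_def
    by (rule one_sided_estimate[OF p m n f g a testing(1) D]) (auto simp: J1_def)
  also have "sum t J2 \<le> 2 * (D + 1) * carleson_const q * Gg + 2 * Ff"
  proof -
    have "1 / q + 1 / p = 1" using p by simp
    then have "(\<Sum>Q\<in>J2. a Q * mass (\<lambda>P. g P * n P) Q * mass (\<lambda>P. f P * m P) Q)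
        \<le> 2 * (D + 1) * carleson_const q * Gg + 2 * Ff"
      unfolding Ff_def Gg_def
      by (intro one_sided_estimate[OF q(1) _ n m g f a testing(2) D]) (auto simp: J2_def)
    then show ?thesis by (simp add: t_def mult_ac)
  qed
  also have "2 * (D + 1) * carleson_const p * Ff + 2 * Gg + (2 * (D + 1) * carleson_const q * Gg + 2 * Ff)
     \<le> (2 * (D + 1) * (carleson_const p + carleson_const q) + 2) * (Ff + Gg)"
    using FG D carleson_const_nonneg[OF p(1)] carleson_const_nonneg[OF q(1)]
    by (simp add: algebra_simps)
  finally show ?thesis by (simp add: t_def Ff_def Gg_def)
qed

text \<open>Duality in explicit form: if \<open>h\<close> is the image of \<open>f\<close>, the
bilinear form at \<open>f\<close> and \<open>g = t h\<^bsup>p-1\<^esup>\<close> is \<open>t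
H\<close>, where \<open>H\<close> is the sum of \<open>h\<^sup>p n\<close>, while
\<open>g\<^sup>q = t\<^sup>q h\<^sup>p\<close>. For the \<open>t\<close> chosen, the term with
\<open>g\<close> in the bilinear estimate is half of the left-hand side.\<close>

lemma strong_type_if_testing:
  assumes p: "1 < p" "1 / p + 1 / q = 1"
    and m: "\<And>P. P \<in> I \<Longrightarrow> 0 \<le> m P" and n: "\<And>P. P \<in> I \<Longrightarrow> 0 \<le> n P"
    and a: "\<And>Q. Q \<in> I \<Longrightarrow> 0 \<le> a Q" and D: "0 \<le> D"
    and testing: "testing p a m n D" "testing q a n m D"
    and K: "K = 2 * (D + 1) * (carleson_const p + carleson_const q) + 2"
  shows "strong_type p a m n ((2 * K) powr (q / (q - 1)))"
  unfolding strong_type_def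
proof (intro allI impI)
  fix f :: "'a \<Rightarrow> real" assume f: "\<forall>P\<in>I. 0 \<le> f P"
  note q = conjugate_exponent[OF p]
  have "0 < K"
    using D carleson_const_nonneg[OF p(1)] carleson_const_nonneg[OF q(1)]
    by (auto simp: K intro!: add_nonneg_pos mult_nonneg_nonneg)
  define t where "t = (2 * K) powr (- 1 / (q - 1))"
  have t: "0 < t" using \<open>0 < K\<close> by (simp add: t_def)
  have tq: "K * t powr q = t / 2"
    using powr_absorb[of "2 * K" q] \<open>0 < K\<close> q(1) by (simp add: t_def)
  define Ff where "Ff = (\<Sum>P\<in>I. f P powr p * m P)"
  define fm where "fm P = f P * m P" for P
  define h where "h P = (\<Sum>Q | Q \<in> I \<and> P \<le> Q. a Q * mass fm Q)" for P
  have h: "0 \<le> h P" for P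
    using a f m by (auto simp: h_def fm_def intro!: sum_nonneg mult_nonneg_nonneg mass_nonneg)
  define H where "H = (\<Sum>P\<in>I. h P powr p * n P)"
  define g where "g P = t * h P powr (p - 1)" for P
  have "t * H = (\<Sum>P\<in>I. h P * (g P * n P))"
  proof -
    have "h P * h P powr (p - 1) = h P powr p" for P
      using h[of P] p powr_add[of "h P" "p - 1" 1] by (cases "h P = 0") (auto simp: mult_ac)
    then have "h P * (g P * n P) = t * (h P powr p * n P)" for P
      by (metis g_def mult.assoc mult.left_commute)
    then show ?thesis by (simp only: H_def sum_distrib_left)
  qed
  also have "\<dots> = (\<Sum>P\<in>I. \<Sum>Q | Q \<in> I \<and> P \<le> Q. a Q * mass fm Q * (g P * n P))"
    by (simp add: h_def sum_distrib_right)
  also have "\<dots> = (\<Sum>Q\<in>I. \<Sum>P | P \<in> I \<and> P \<le> Q. a Q * mass fm Q * (g P * n P))"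
    using finite_I finite_I by (rule sum.swap_restrict)
  also have "\<dots> = (\<Sum>Q\<in>I. a Q * mass fm Q * mass (\<lambda>P. g P * n P) Q)"
    by (simp add: mass_def below_def sum_distrib_left)
  also have "\<dots> \<le> K * (Ff + (\<Sum>P\<in>I. g P powr q * n P))"
    unfolding fm_def[abs_def] Ff_def K using f h t
    by (intro bilinear_estimate[OF p m n _ _ a D testing]) (auto simp: g_def)
  also have "(\<Sum>P\<in>I. g P powr q * n P) = t powr q * H"
    using t h q by (simp add: g_def H_def sum_distrib_left powr_mult powr_powr mult_ac)
  also have "K * (Ff + t powr q * H) = K * Ff + (K * t powr q) * H"
    by (simp add: algebra_simps)
  finally have "t * H \<le> K * Ff + t / 2 * H"
    unfolding tq .
  then have "H \<le> 2 * K / t * Ff"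
    using t by (simp add: field_simps)
  also have "2 * K / t = (2 * K) powr (q / (q - 1))"
  proof -
    have "2 * K / t = (2 * K) powr (1 + 1 / (q - 1))"
      using \<open>0 < K\<close> by (simp add: t_def powr_add powr_minus divide_inverse)
    also have "1 + 1 / (q - 1) = q / (q - 1)" using q(1) by (simp add: field_simps)
    finally show ?thesis .
  qed
  finally show "(\<Sum>P\<in>I. (\<Sum>Q | Q \<in> I \<and> P \<le> Q. a Q * mass (\<lambda>P. f P * m P) Q) powr p * n P)
      \<le> (2 * K) powr (q / (q - 1)) * (\<Sum>P\<in>I. f P powr p * m P)"
    by (simp add: H_def h_def fm_def[abs_def] Ff_def)
qed

text \<open>Apply the norm inequality to the indicator of \<open>R\<close>; the cubes not
contained in \<open>R\<close> only increase the image.\<close>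

lemma testing_if_strong_type:
  assumes p: "1 < p"
    and m: "\<And>P. P \<in> I \<Longrightarrow> 0 \<le> m P" and n: "\<And>P. P \<in> I \<Longrightarrow> 0 \<le> n P"
    and a: "\<And>Q. Q \<in> I \<Longrightarrow> 0 \<le> a Q"
    and strong: "strong_type p a m n B"
  shows "testing p a m n B"
  unfolding testing_def
proof
  fix R assume R: "R \<in> I"
  define f :: "'a \<Rightarrow> real" where "f P = of_bool (P \<le> R)" for P
  define k where "k P = (\<Sum>Q | Q \<in> I \<and> P \<le> Q. a Q * mass (\<lambda>P. f P * m P) Q)" for P
  have mass0: "0 \<le> mass (\<lambda>P. f P * m P) Q" for Q
    using m by (intro mass_nonneg) (simp add: f_def)
  have "(\<Sum>P\<in>below R. (\<Sum>Q | Q \<in> I \<and> P \<le> Q \<and> Q \<le> R. a Q * mass m Q) powr p * n P)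
      \<le> (\<Sum>P\<in>below R. k P powr p * n P)"
  proof (intro sum_mono mult_right_mono powr_mono2)
    fix P assume P: "P \<in> below R"
    have "mass m Q = mass (\<lambda>P. f P * m P) Q" if "Q \<le> R" for Q
      using that by (auto simp: mass_def f_def below_def intro!: sum.cong)
    then have "(\<Sum>Q | Q \<in> I \<and> P \<le> Q \<and> Q \<le> R. a Q * mass m Q)
        = (\<Sum>Q | Q \<in> I \<and> P \<le> Q \<and> Q \<le> R. a Q * mass (\<lambda>P. f P * m P) Q)"
      by (intro sum.cong) auto
    also have "\<dots> \<le> k P"
      unfolding k_def using finite_I a mass0 by (intro sum_mono2) auto
    finally show "(\<Sum>Q | Q \<in> I \<and> P \<le> Q \<and> Q \<le> R. a Q * mass m Q) \<le> k P" .
    show "0 \<le> n P" using P n below_subset by blast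
  qed (use p a m in \<open>auto intro!: sum_nonneg mult_nonneg_nonneg mass_nonneg\<close>)
  also have "\<dots> \<le> (\<Sum>P\<in>I. k P powr p * n P)"
    using finite_I n below_subset by (intro sum_mono2) auto
  also have "\<dots> \<le> B * (\<Sum>P\<in>I. f P powr p * m P)"
    using strong unfolding strong_type_def k_def by (auto simp: f_def)
  also have "(\<Sum>P\<in>I. f P powr p * m P) = mass m R"
    unfolding mass_def below_def using finite_I p
    by (subst sum.inter_filter) (auto simp: f_def intro!: sum.cong)
  finally show "(\<Sum>P\<in>below R. (\<Sum>Q | Q \<in> I \<and> P \<le> Q \<and> Q \<le> R. a Q * mass m Q) powr p * n P)
      \<le> B * mass m R" .
qed

text \<open>Let \<open>h\<close> be the image of the indicator of \<open>R\<close> under the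
dual operator localized to \<open>R\<close>, and let \<open>f = h\<^bsup>q-1\<^esup>\<close> on
\<open>R\<close>. Then \<open>h\<^sup>q = h f\<close> and \<open>f\<^sup>p = h\<^sup>q\<close>.
Moving the operator from the indicator to \<open>f\<close>, the sum \<open>H\<close> of
\<open>h\<^sup>q m\<close> becomes at most the sum over \<open>R\<close> of \<open>k n\<close>,
where \<open>k\<close> is the image of \<open>f\<close>; the norm inequality bounds the sum of
\<open>k\<^sup>p n\<close> by \<open>B H\<close>. Young's inequality for \<open>t k\<close> and
the constant 1, with \<open>t\<close> small, lets \<open>H\<close> be absorbed on the
left.\<close>

lemma dual_testing_if_strong_type:
  assumes p: "1 < p" "1 / p + 1 / q = 1"
    and m: "\<And>P. P \<in> I \<Longrightarrow> 0 \<le> m P" and n: "\<And>P. P \<in> I \<Longrightarrow> 0 \<le> n P"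
    and a: "\<And>Q. Q \<in> I \<Longrightarrow> 0 \<le> a Q" and B: "0 < B"
    and strong: "strong_type p a m n B"
  shows "testing q a n m (2 * (2 * B) powr (1 / (p - 1)))"
  unfolding testing_def
proof
  fix R assume R: "R \<in> I"
  note q = conjugate_exponent[OF p]
  define t where "t = (2 * B) powr (- 1 / (p - 1))"
  have t: "0 < t" using B by (simp add: t_def)
  have tp: "t powr p * B = t / 2"
    using powr_absorb[of "2 * B" p] B p(1) by (simp add: t_def mult.commute)
  define h where "h P = (\<Sum>Q | Q \<in> I \<and> P \<le> Q \<and> Q \<le> R. a Q * mass n Q)" for P
  have h: "0 \<le> h P" for P
    using a n by (auto simp: h_def intro!: sum_nonneg mult_nonneg_nonneg mass_nonneg)
  define H where "H = (\<Sum>P\<in>below R. h P powr q * m P)"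
  define f where "f P = (if P \<le> R then h P powr (q - 1) else 0)" for P
  define fm where "fm P = f P * m P" for P
  have fm: "0 \<le> fm P" if "P \<in> I" for P using that m by (simp add: fm_def f_def)
  have fp: "(\<Sum>P\<in>I. f P powr p * m P) = H"
    unfolding H_def below_def using finite_I p q h
    by (subst sum.inter_filter) (auto simp: f_def powr_powr intro!: sum.cong)
  define k where "k P = (\<Sum>Q | Q \<in> I \<and> P \<le> Q. a Q * mass fm Q)" for P
  have k: "0 \<le> k P" for P
    using a fm by (auto simp: k_def intro!: sum_nonneg mult_nonneg_nonneg mass_nonneg)
  have "H = (\<Sum>P\<in>below R. h P * fm P)"
  proof -
    have "h P powr (q - 1) * h P = h P powr q" for P
      using h[of P] q powr_add[of "h P" "q - 1" 1] by (cases "h P = 0") auto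
    then show ?thesis
      unfolding H_def fm_def f_def below_def by (intro sum.cong) (auto simp: mult_ac)
  qed
  also have "\<dots> = (\<Sum>P\<in>below R. \<Sum>Q | Q \<in> below R \<and> P \<le> Q. a Q * mass n Q * fm P)"
    unfolding h_def sum_distrib_right by (intro sum.cong) (auto simp: below_def)
  also have "\<dots> = (\<Sum>Q\<in>below R. \<Sum>P | P \<in> below R \<and> P \<le> Q. a Q * mass n Q * fm P)"
    by (rule sum.swap_restrict) simp_all
  also have "\<dots> = (\<Sum>Q\<in>below R. a Q * mass n Q * mass fm Q)"
    unfolding mass_def sum_distrib_left[symmetric]
    by (intro sum.cong arg_cong2[of _ _ _ _ "(*)"]) (auto simp: below_def)
  also have "\<dots> = (\<Sum>Q\<in>below R. \<Sum>P | P \<in> below R \<and> P \<le> Q. a Q * mass fm Q * n P)"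
    unfolding mass_def[of n] sum_distrib_left[symmetric] mult.assoc[of _ _ "mass fm _"]
      mult.commute[of "sum n _"] mult.assoc[of _ "mass fm _", symmetric]
    by (intro sum.cong arg_cong2[of _ _ _ _ "(*)"]) (auto simp: below_def)
  also have "\<dots> = (\<Sum>P\<in>below R. \<Sum>Q | Q \<in> below R \<and> P \<le> Q. a Q * mass fm Q * n P)"
    by (rule sum.swap_restrict[symmetric]) simp_all
  also have "\<dots> \<le> (\<Sum>P\<in>below R. k P * n P)"
  proof (intro sum_mono)
    fix P assume "P \<in> below R"
    then have "0 \<le> n P" using n below_subset by blast
    have "(\<Sum>Q | Q \<in> below R \<and> P \<le> Q. a Q * mass fm Q) \<le> k P"
      unfolding k_def using finite_I a fm
      by (intro sum_mono2) (auto simp: below_def intro!: mult_nonneg_nonneg mass_nonneg)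
    then show "(\<Sum>Q | Q \<in> below R \<and> P \<le> Q. a Q * mass fm Q * n P) \<le> k P * n P"
      using \<open>0 \<le> n P\<close> by (simp add: sum_distrib_right[symmetric] mult_right_mono)
  qed
  finally have "t * H \<le> t * (\<Sum>P\<in>below R. k P * n P)"
    using t by simp
  also have "\<dots> \<le> (\<Sum>P\<in>below R. t powr p * (k P powr p * n P) + n P)"
    unfolding sum_distrib_left
  proof (rule sum_mono)
    fix P assume "P \<in> below R"
    then have "0 \<le> n P" using n below_subset by blast
    have "t * k P * 1 \<le> (t * k P) powr p + 1 powr q"
      using p t k by (intro Young_unweighted) auto
    then have "t * k P * n P \<le> (t powr p * k P powr p + 1) * n P"
      using t k \<open>0 \<le> n P\<close> by (intro mult_right_mono) (auto simp: powr_mult)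
    then show "t * (k P * n P) \<le> t powr p * (k P powr p * n P) + n P"
      by (simp add: algebra_simps)
  qed
  also have "\<dots> = t powr p * (\<Sum>P\<in>below R. k P powr p * n P) + mass n R"
    by (simp add: sum.distrib mass_def sum_distrib_left)
  also have "(\<Sum>P\<in>below R. k P powr p * n P) \<le> (\<Sum>P\<in>I. k P powr p * n P)"
    using finite_I n below_subset by (intro sum_mono2) auto
  also have "\<dots> \<le> B * H"
    using strong unfolding strong_type_def k_def fm_def[abs_def] fp[symmetric] by (auto simp: f_def)
  finally have "t * H \<le> t powr p * (B * H) + mass n R" by (simp add: mult_left_mono)
  then have "t * H \<le> t / 2 * H + mass n R"
    using tp by (simp add: mult.assoc[symmetric])
  then have "H \<le> 2 / t * mass n R"
    using t by (simp add: field_simps)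
  also have "2 / t = 2 * (2 * B) powr (1 / (p - 1))"
    using B by (simp add: t_def powr_minus divide_simps)
  finally show "(\<Sum>P\<in>below R. (\<Sum>Q | Q \<in> I \<and> P \<le> Q \<and> Q \<le> R. a Q * mass n Q) powr q * m P)
      \<le> 2 * (2 * B) powr (1 / (p - 1)) * mass n R"
    by (simp add: H_def h_def)
qed

end

section \<open>Powers of extended reals\<close>

lemma epowr_ennreal: "0 \<le> r \<Longrightarrow> epowr (ennreal r) a = ennreal (r powr a)"
  by (simp add: epowr_def)

lemma epowr_mono:
  assumes "x \<le> y" "0 \<le> a"
  shows "epowr x a \<le> epowr y a"
proof (cases "y = \<infinity>")
  case False
  then have "x \<noteq> \<infinity>" using assms(1) by (auto simp: top_unique)
  then show ?thesis
    using False assms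
    by (auto simp: epowr_def infinity_ennreal_def less_top intro!: ennreal_leI powr_mono2 enn2real_mono)
qed (simp add: epowr_def)

lemma epowr_inverse:
  assumes "0 < a"
  shows "epowr (epowr x a) (1 / a) = x"
  using assms by (cases x) (auto simp: epowr_def powr_powr)

lemma epowr_le_iff:
  assumes "0 < a"
  shows "epowr x a \<le> y \<longleftrightarrow> x \<le> epowr y (1 / a)"
  using epowr_mono[of "epowr x a" y "1 / a"] epowr_mono[of x "epowr y (1 / a)" a]
    epowr_inverse[of a x] epowr_inverse[of "1 / a" y] assms by auto

lemma epowr_SUP:
  assumes "0 < a" "A \<noteq> {}"
  shows "epowr (SUP i\<in>A. s i) a = (SUP i\<in>A. epowr (s i) a)"
proof (rule antisym)
  have "s i \<le> epowr (SUP i\<in>A. epowr (s i) a) (1 / a)" if "i \<in> A" for i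
    using that assms by (subst epowr_le_iff[symmetric]) (auto intro: SUP_upper)
  then show "epowr (SUP i\<in>A. s i) a \<le> (SUP i\<in>A. epowr (s i) a)"
    using assms(1) by (subst epowr_le_iff) (auto intro: SUP_least)
  show "(SUP i\<in>A. epowr (s i) a) \<le> epowr (SUP i\<in>A. s i) a"
    using assms by (intro SUP_least epowr_mono SUP_upper) auto
qed

lemma Lp_norm_le_iff:
  assumes "0 < p" "0 \<le> c"
  shows "Lp_norm p w g \<le> ennreal c \<longleftrightarrow>
    (\<integral>\<^sup>+ x. epowr (g x) p * ennreal (w x) \<partial>lebesgue) \<le> ennreal (c powr p)"
  unfolding Lp_norm_def using assms by (subst epowr_le_iff) (auto simp: epowr_ennreal)

section \<open>Dyadic cubes\<close>

lemma mem_dyadic_cube_iff: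
  "x \<in> dyadic_cube k m \<longleftrightarrow> (\<forall>i. \<lfloor>2 powi k * x $ i\<rfloor> = m $ i)"
proof -
  have "2 powi (- k) * real_of_int j \<le> t \<and> t < 2 powi (- k) * (real_of_int j + 1)
    \<longleftrightarrow> \<lfloor>2 powi k * t\<rfloor> = j" for j and t :: real
    unfolding floor_eq_iff by (simp add: power_int_minus field_simps)
  then show ?thesis by (simp add: dyadic_cube_def)
qed

text \<open>The cube of side \<open>2\<^bsup>-k\<^esup>\<close> around a point is determined by
the integer parts of its coordinates scaled by \<open>2\<^sup>k\<close>. These are obtained from
those at a finer scale by integer division.\<close>

lemma dyadic_cube_nested_aux:
  assumes "k \<le> k'" "x \<in> dyadic_cube k m" "x \<in> dyadic_cube k' m'"
  shows "dyadic_cube k' m' \<subseteq> dyadic_cube k m"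
proof
  fix y assume y: "y \<in> dyadic_cube k' m'"
  have *: "\<lfloor>2 powi k * t\<rfloor> = \<lfloor>2 powi k' * t\<rfloor> div 2 ^ nat (k' - k)" for t :: real
  proof -
    have "(2::real) powi k' = 2 powi k * 2 ^ nat (k' - k)"
      using assms(1) power_int_add[of "2::real" k "k' - k"] by (simp add: power_int_def)
    then have "2 powi k * t = 2 powi k' * t / real_of_int (2 ^ nat (k' - k))" by simp
    then show ?thesis by (simp only: floor_divide_real_eq_div zero_le_power zero_le_numeral)
  qed
  have "\<lfloor>2 powi k * y $ i\<rfloor> = \<lfloor>2 powi k * x $ i\<rfloor>" for i
    using y assms(3) unfolding * by (simp add: mem_dyadic_cube_iff)
  then show "y \<in> dyadic_cube k m" using assms(2) by (simp add: mem_dyadic_cube_iff)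
qed

lemma dyadic_cubes_nested:
  assumes "Q \<in> dyadic_cubes" "Q' \<in> dyadic_cubes" "x \<in> Q" "x \<in> Q'"
  shows "Q \<subseteq> Q' \<or> Q' \<subseteq> Q"
proof -
  obtain k m k' m' where "Q = dyadic_cube k m" "Q' = dyadic_cube k' m'"
    using assms(1,2) by (auto simp: dyadic_cubes_def)
  then show ?thesis
    using dyadic_cube_nested_aux[of k k' x m m'] dyadic_cube_nested_aux[of k' k x m' m] assms(3,4)
    by (cases "k \<le> k'") auto
qed

lemma dyadic_cubes_nonempty:
  assumes "Q \<in> dyadic_cubes"
  shows "Q \<noteq> {}"
proof -
  obtain k m where Q: "Q = dyadic_cube k m" using assms by (auto simp: dyadic_cubes_def)
  have "(\<chi> i. 2 powi (- k) * real_of_int (m $ i)) \<in> Q"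
    by (simp add: Q dyadic_cube_def)
  then show ?thesis by blast
qed

lemma countable_dyadic_cubes: "countable (dyadic_cubes :: (real ^ 'n) set set)"
proof -
  have "countable ((\<lambda>(k, m). dyadic_cube k (m :: int ^ 'n)) ` (UNIV \<times> UNIV))"
    by (intro countable_image countable_SIGMA) auto
  then show ?thesis
    by (rule countable_subset[rotated]) (auto simp: dyadic_cubes_def)
qed

lemma dyadic_cube_measurable:
  assumes "Q \<in> dyadic_cubes"
  shows "Q \<in> sets lebesgue"
proof -
  obtain k m where Q: "Q = dyadic_cube k m" using assms by (auto simp: dyadic_cubes_def)
  have "Q = (\<Inter>i. {x. 2 powi (- k) * real_of_int (m $ i) \<le> x $ i} \<inter>
                 {x. x $ i < 2 powi (- k) * (real_of_int (m $ i) + 1)})"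
    by (auto simp: Q dyadic_cube_def)
  also have "\<dots> \<in> sets borel"
    by (intro sets.countable_INT' sets.Int borel_closed borel_open
        closed_halfspace_component_ge_cart open_halfspace_component_lt_cart) auto
  finally show ?thesis by (simp add: sets_completionI_sets)
qed

lemma dyadic_cube_bounded:
  assumes "Q \<in> dyadic_cubes"
  obtains a b where "Q \<subseteq> cbox a (b :: real ^ 'n)"
proof -
  obtain k m where Q: "Q = dyadic_cube k m" using assms by (auto simp: dyadic_cubes_def)
  have "Q \<subseteq> cbox (\<chi> i. 2 powi (- k) * real_of_int (m $ i))
                 (\<chi> i. 2 powi (- k) * (real_of_int (m $ i) + 1))"
    unfolding Q dyadic_cube_def by (auto simp: mem_box_cart simp del: power_int_minus) (meson less_imp_le)
  then show thesis by (rule that)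
qed

lemma locally_integrable_cube:
  assumes "locally_integrable w" "Q \<in> dyadic_cubes" "A \<subseteq> Q" "A \<in> sets lebesgue"
  shows "set_integrable lebesgue A w"
proof -
  obtain a b where "Q \<subseteq> cbox a b" using dyadic_cube_bounded[OF assms(2)] .
  moreover have "set_integrable lebesgue (cbox a b) w"
    using assms(1) by (simp add: locally_integrable_def)
  ultimately show ?thesis using assms by (intro set_integrable_subset[of _ "cbox a b" _ A]) auto
qed

lemma weight_measure_nonneg: "(\<And>x. 0 \<le> w x) \<Longrightarrow> 0 \<le> weight_measure w A"
  unfolding weight_measure_def set_lebesgue_integral_def by (intro integral_nonneg_AE) auto

section \<open>Monotone convergence over finite families of cubes\<close>

text \<open>The infinite sum is the supremum of the sums over finite subfamilies, but these are
only directed by inclusion, while monotone convergence needs a sequence. An increasing sequence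
\<open>In\<close> of finite subfamilies that exhausts the countable set \<open>X\<close> has the
same supremum.\<close>

lemma nn_integral_epowr_infsum_le_iff:
  fixes X :: "(real ^ 'n) set set"
  assumes X: "X \<subseteq> dyadic_cubes" and c: "\<And>Q. Q \<in> X \<Longrightarrow> 0 \<le> c Q" and p: "0 < p"
    and w: "w \<in> borel_measurable lebesgue"
  shows "(\<integral>\<^sup>+ x. epowr (\<Sum>\<^sub>\<infinity>Q\<in>X. ennreal (c Q * indicator Q x)) p * ennreal (w x) \<partial>lebesgue) \<le> B \<longleftrightarrow>
    (\<forall>I. finite I \<and> I \<subseteq> X \<longrightarrow>
      (\<integral>\<^sup>+ x. ennreal ((\<Sum>Q\<in>I. c Q * indicator Q x) powr p) * ennreal (w x) \<partial>lebesgue) \<le> B)"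
    (is "?L \<longleftrightarrow> ?R")
proof -
  define s where "s I x = (\<Sum>Q\<in>I. c Q * indicator Q x)" for I and x :: "real ^ 'n"
  have s0: "0 \<le> s I x" if "I \<subseteq> X" for I x
    using that c by (auto simp: s_def intro!: sum_nonneg)
  have s_ennreal: "(\<Sum>Q\<in>I. ennreal (c Q * indicator Q x)) = ennreal (s I x)" if "I \<subseteq> X" for I x
    unfolding s_def using that c by (intro sum_ennreal) auto
  have infsum: "(\<Sum>\<^sub>\<infinity>Q\<in>X. ennreal (c Q * indicator Q x)) = (SUP I\<in>{I. finite I \<and> I \<subseteq> X}. ennreal (s I x))" for x
    using s_ennreal by (subst nonneg_infsum_complete) (auto intro!: SUP_cong)
  show ?thesis
  proof
    assume L: ?L
    show ?R
    proof (intro allI impI)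
      fix I assume I: "finite I \<and> I \<subseteq> X"
      have "(\<integral>\<^sup>+ x. ennreal (s I x powr p) * ennreal (w x) \<partial>lebesgue)
        \<le> (\<integral>\<^sup>+ x. epowr (\<Sum>\<^sub>\<infinity>Q\<in>X. ennreal (c Q * indicator Q x)) p * ennreal (w x) \<partial>lebesgue)"
      proof (intro nn_integral_mono mult_right_mono)
        fix x
        have "ennreal (s I x powr p) = epowr (ennreal (s I x)) p"
          using s0[of I x] I by (simp add: epowr_ennreal)
        also have "\<dots> \<le> epowr (\<Sum>\<^sub>\<infinity>Q\<in>X. ennreal (c Q * indicator Q x)) p"
          unfolding infsum using p I by (intro epowr_mono SUP_upper) auto
        finally show "ennreal (s I x powr p) \<le> epowr (\<Sum>\<^sub>\<infinity>Q\<in>X. ennreal (c Q * indicator Q x)) p" .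
      qed simp
      then show "(\<integral>\<^sup>+ x. ennreal ((\<Sum>Q\<in>I. c Q * indicator Q x) powr p) * ennreal (w x) \<partial>lebesgue) \<le> B"
        using L unfolding s_def by (rule order_trans)
    qed
  next
    assume R: ?R
    have cX: "countable X" using X countable_dyadic_cubes countable_subset by blast
    define In where "In n = {Q \<in> X. to_nat_on X Q \<le> n}" for n
    have finIn: "finite (In n)" for n
    proof -
      have "inj_on (to_nat_on X) (In n)"
        using inj_on_to_nat_on[OF cX] by (rule inj_on_subset) (auto simp: In_def)
      moreover have "to_nat_on X ` In n \<subseteq> {..n}" by (auto simp: In_def)
      ultimately show ?thesis using finite_subset finite_imageD by blast
    qed
    have InX: "In n \<subseteq> X" for n by (auto simp: In_def)
    have mono_s: "s I x \<le> s I' x" if "I \<subseteq> I'" "finite I'" "I' \<subseteq> X" for I I' x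
      unfolding s_def using that c by (intro sum_mono2) auto
    have "(SUP I\<in>{I. finite I \<and> I \<subseteq> X}. ennreal (s I x)) = (SUP n. ennreal (s (In n) x))" for x
    proof (rule antisym)
      show "(SUP I\<in>{I. finite I \<and> I \<subseteq> X}. ennreal (s I x)) \<le> (SUP n. ennreal (s (In n) x))"
      proof (rule SUP_least)
        fix I assume "I \<in> {I. finite I \<and> I \<subseteq> X}"
        then have "I \<subseteq> In (Max (to_nat_on X ` I))" by (auto simp: In_def)
        then have "ennreal (s I x) \<le> ennreal (s (In (Max (to_nat_on X ` I))) x)"
          using mono_s finIn InX by (intro ennreal_leI) auto
        then show "ennreal (s I x) \<le> (SUP n. ennreal (s (In n) x))"
          by (rule SUP_upper2[OF UNIV_I])
      qed
      show "(SUP n. ennreal (s (In n) x)) \<le> (SUP I\<in>{I. finite I \<and> I \<subseteq> X}. ennreal (s I x))"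
        using finIn InX by (intro SUP_least SUP_upper) auto
    qed
    then have "epowr (\<Sum>\<^sub>\<infinity>Q\<in>X. ennreal (c Q * indicator Q x)) p * ennreal (w x)
        = (SUP n. ennreal (s (In n) x powr p) * ennreal (w x))" for x
      using p s0[OF InX] unfolding infsum
      by (simp add: epowr_SUP epowr_ennreal SUP_mult_right_ennreal)
    then have "(\<integral>\<^sup>+ x. epowr (\<Sum>\<^sub>\<infinity>Q\<in>X. ennreal (c Q * indicator Q x)) p * ennreal (w x) \<partial>lebesgue)
        = (\<integral>\<^sup>+ x. (SUP n. ennreal (s (In n) x powr p) * ennreal (w x)) \<partial>lebesgue)"
      by simp
    also have "\<dots> = (SUP n. \<integral>\<^sup>+ x. ennreal (s (In n) x powr p) * ennreal (w x) \<partial>lebesgue)"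
    proof (rule nn_integral_monotone_convergence_SUP)
      show "incseq (\<lambda>n x. ennreal (s (In n) x powr p) * ennreal (w x))"
      proof (intro incseq_SucI le_funI mult_right_mono ennreal_leI powr_mono2)
        fix n x
        show "s (In n) x \<le> s (In (Suc n)) x"
          using finIn InX by (intro mono_s) (auto simp: In_def)
      qed (use p s0[OF InX] in auto)
      have "Q \<in> sets lebesgue" if "Q \<in> In n" for Q n
        using that InX X dyadic_cube_measurable by blast
      then have "s (In n) \<in> borel_measurable lebesgue" for n
        unfolding s_def[abs_def]
        by (intro borel_measurable_sum borel_measurable_times borel_measurable_const
            borel_measurable_indicator)
      then show "(\<lambda>x. ennreal (s (In n) x powr p) * ennreal (w x)) \<in> borel_measurable lebesgue" for n
        using w by measurable
    qed
    also have "\<dots> \<le> B"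
      using R finIn InX unfolding s_def by (intro SUP_least) auto
    finally show ?L .
  qed
qed

section \<open>Atoms of a finite family of dyadic cubes\<close>

locale dyadic_family =
  fixes I :: "(real ^ 'n) set set"
  assumes finite_family: "finite I" and dyadic: "I \<subseteq> dyadic_cubes"
begin

sublocale finite_forest I
proof
  fix P Q Q' assume PQ: "P \<in> I" "Q \<in> I" "Q' \<in> I" "P \<le> Q" "P \<le> Q'"
  then obtain x where "x \<in> P" using dyadic dyadic_cubes_nonempty by blast
  then show "Q \<le> Q' \<or> Q' \<le> Q"
    using PQ dyadic dyadic_cubes_nested[of Q Q' x] by blast
qed (rule finite_family)

text \<open>The atoms partition the union of the family, and a cube of the family meets the atom
of \<open>P\<close> only if it contains \<open>P\<close>. An atom may be empty or a null
set.\<close>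

definition atom :: "(real ^ 'n) set \<Rightarrow> (real ^ 'n) set" where
  "atom P = P - \<Union>{P' \<in> I. P' \<subset> P}"

lemma atom_subset: "atom P \<subseteq> P"
  by (auto simp: atom_def)

lemma sets_atom: "P \<in> I \<Longrightarrow> atom P \<in> sets lebesgue"
  unfolding atom_def using finite_family dyadic dyadic_cube_measurable
  by (intro sets.Diff sets.finite_Union) auto

lemma mem_iff_atom_subset:
  assumes "P \<in> I" "Q \<in> I" "x \<in> atom P"
  shows "x \<in> Q \<longleftrightarrow> P \<subseteq> Q"
proof
  assume "x \<in> Q"
  moreover have "x \<in> P" using assms(3) atom_subset by blast
  ultimately have "P \<subseteq> Q \<or> Q \<subseteq> P"
    using dyadic_cubes_nested[of P Q x] assms dyadic by blast
  moreover have "\<not> Q \<subset> P" using assms \<open>x \<in> Q\<close> by (auto simp: atom_def)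
  ultimately show "P \<subseteq> Q" by blast
qed (use assms(3) atom_subset in blast)

lemma atom_unique:
  assumes "P \<in> I" "P' \<in> I" "x \<in> atom P" "x \<in> atom P'"
  shows "P = P'"
  using mem_iff_atom_subset[OF assms(1,2,3)] mem_iff_atom_subset[OF assms(2,1,4)]
    assms(3,4) atom_subset by blast

lemma ex_atom:
  assumes "Q \<in> I" "x \<in> Q"
  obtains P where "P \<in> I" "P \<subseteq> Q" "x \<in> atom P"
proof -
  have "finite {P \<in> I. x \<in> P}" using finite_family by simp
  from finite_has_minimal2[OF this, of Q] assms obtain P
    where P: "P \<in> I" "x \<in> P" "P \<subseteq> Q"
      and minimal: "\<And>P'. P' \<in> I \<Longrightarrow> x \<in> P' \<Longrightarrow> P' \<subseteq> P \<Longrightarrow> P = P'"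
    by auto
  have "x \<in> atom P" using P minimal unfolding atom_def by blast
  then show thesis using that P by blast
qed

definition step :: "((real ^ 'n) set \<Rightarrow> real) \<Rightarrow> real ^ 'n \<Rightarrow> real" where
  "step v x = (\<Sum>P\<in>I. v P * indicator (atom P) x)"

lemma step_on_atom:
  assumes "P \<in> I" "x \<in> atom P"
  shows "step v x = v P"
proof -
  have "step v x = (\<Sum>P'\<in>{P}. v P' * indicator (atom P') x)"
    unfolding step_def using assms finite_family atom_unique
    by (intro sum.mono_neutral_right) (auto simp: indicator_def)
  then show ?thesis using assms by simp
qed

lemma step_outside: "x \<notin> \<Union>I \<Longrightarrow> step v x = 0"
  unfolding step_def using atom_subset by (intro sum.neutral) (auto simp: indicator_def)

lemma step_cases:
  obtains (atom) P where "P \<in> I" "x \<in> atom P" "\<And>v. step v x = v P"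
  | (outside) "x \<notin> \<Union>I" "\<And>v. step v x = 0"
proof (cases "x \<in> \<Union>I")
  case True
  then obtain Q where "Q \<in> I" "x \<in> Q" by blast
  then obtain P where "P \<in> I" "x \<in> atom P" using ex_atom by blast
  then show thesis using atom step_on_atom by blast
next
  case False
  then show thesis using outside step_outside by blast
qed

lemma step_nonneg: "(\<And>P. P \<in> I \<Longrightarrow> 0 \<le> v P) \<Longrightarrow> 0 \<le> step v x"
  by (auto simp: step_def intro!: sum_nonneg)

lemma step_powr: "0 < p \<Longrightarrow> step v x powr p = step (\<lambda>P. v P powr p) x"
  by (cases x rule: step_cases) auto

text \<open>The operator restricted to a finite family produces functions that are constant on
atoms, which is why integrals of their powers are finite sums over the forest.\<close>

lemma sum_indicator_eq_step:
  "(\<Sum>Q\<in>I. c Q * indicator Q x) = step (\<lambda>P. \<Sum>Q | Q \<in> I \<and> P \<subseteq> Q. c Q) x"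
proof (cases x rule: step_cases)
  case (atom P)
  have "(\<Sum>Q\<in>I. c Q * indicator Q x) = (\<Sum>Q\<in>I. if P \<subseteq> Q then c Q else 0)"
    using mem_iff_atom_subset[OF atom(1) _ atom(2)]
    by (intro sum.cong) (auto simp: indicator_def)
  also have "\<dots> = (\<Sum>Q | Q \<in> I \<and> P \<subseteq> Q. c Q)"
    using finite_family by (simp add: sum.inter_filter)
  finally show ?thesis using atom(3) by simp
next
  case outside
  then show ?thesis by (subst outside(2), intro sum.neutral) (auto simp: indicator_def)
qed

lemma indicator_eq_step: "Q \<in> I \<Longrightarrow> indicator Q x = step (\<lambda>P. of_bool (P \<subseteq> Q)) x"
  by (cases x rule: step_cases) (auto simp: indicator_def mem_iff_atom_subset)

abbreviation atom_weight :: "(real ^ 'n \<Rightarrow> real) \<Rightarrow> (real ^ 'n) set \<Rightarrow> real" where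
  "atom_weight w P \<equiv> weight_measure w (atom P)"

context
  fixes w :: "real ^ 'n \<Rightarrow> real"
  assumes int: "\<And>P. P \<in> I \<Longrightarrow> set_integrable lebesgue (atom P) w"
begin

lemma integral_step:
  shows "integrable lebesgue (\<lambda>x. step v x * w x)"
    and "(\<integral>x. step v x * w x \<partial>lebesgue) = (\<Sum>P\<in>I. v P * atom_weight w P)"
proof -
  have eq: "(\<lambda>x. step v x * w x) = (\<lambda>x. \<Sum>P\<in>I. v P * (indicator (atom P) x *\<^sub>R w x))"
    by (simp add: step_def sum_distrib_right mult.assoc)
  show "integrable lebesgue (\<lambda>x. step v x * w x)"
    unfolding eq using int by (intro Bochner_Integration.integrable_sum integrable_mult_right) (auto simp: set_integrable_def)
  show "(\<integral>x. step v x * w x \<partial>lebesgue) = (\<Sum>P\<in>I. v P * atom_weight w P)"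
    unfolding eq using int
    by (subst Bochner_Integration.integral_sum)
      (auto simp: set_integrable_def weight_measure_def set_lebesgue_integral_def)
qed

lemma weight_measure_step:
  assumes "Q \<in> I"
  shows "weight_measure (\<lambda>x. step v x * w x) Q = mass (\<lambda>P. v P * atom_weight w P) Q"
proof -
  have "weight_measure (\<lambda>x. step v x * w x) Q = (\<integral>x. step (\<lambda>P. of_bool (P \<subseteq> Q) * v P) x * w x \<partial>lebesgue)"
    unfolding weight_measure_def set_lebesgue_integral_def
  proof (intro Bochner_Integration.integral_cong refl)
    fix x show "indicator Q x *\<^sub>R (step v x * w x) = step (\<lambda>P. of_bool (P \<subseteq> Q) * v P) x * w x"
      unfolding indicator_eq_step[OF assms] by (cases x rule: step_cases) auto
  qed
  also have "\<dots> = (\<Sum>P\<in>I. of_bool (P \<subseteq> Q) * v P * atom_weight w P)"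
    by (rule integral_step(2))
  also have "\<dots> = mass (\<lambda>P. v P * atom_weight w P) Q"
    unfolding mass_def below_def using finite_family
    by (subst sum.inter_filter) (auto intro!: sum.cong)
  finally show ?thesis .
qed

lemma weight_measure_eq_mass:
  assumes "Q \<in> I"
  shows "weight_measure w Q = mass (atom_weight w) Q"
proof -
  have "indicator Q x *\<^sub>R w x = indicator Q x *\<^sub>R (step (\<lambda>_. 1) x * w x)" for x
    using assms by (cases x rule: step_cases) (auto simp: indicator_def)
  then have "weight_measure w Q = weight_measure (\<lambda>x. step (\<lambda>_. 1) x * w x) Q"
    unfolding weight_measure_def set_lebesgue_integral_def by (simp only:)
  then show ?thesis using weight_measure_step[OF assms, of "\<lambda>_. 1"] by simp
qed

lemma nn_integral_step:
  assumes "\<And>P. P \<in> I \<Longrightarrow> 0 \<le> v P" "\<And>x. 0 \<le> w x"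
  shows "(\<integral>\<^sup>+ x. ennreal (step v x) * ennreal (w x) \<partial>lebesgue)
    = ennreal (\<Sum>P\<in>I. v P * atom_weight w P)"
proof -
  have "(\<integral>\<^sup>+ x. ennreal (step v x) * ennreal (w x) \<partial>lebesgue) = (\<integral>\<^sup>+ x. ennreal (step v x * w x) \<partial>lebesgue)"
    using assms step_nonneg by (intro nn_integral_cong) (simp add: ennreal_mult)
  also have "\<dots> = ennreal (\<integral>x. step v x * w x \<partial>lebesgue)"
    using assms step_nonneg by (intro nn_integral_eq_integral integral_step) auto
  finally show ?thesis by (simp add: integral_step(2))
qed

lemma nn_integral_sum_indicator_powr:
  assumes "\<And>x. 0 \<le> w x" "0 < p"
  shows "(\<integral>\<^sup>+ x. ennreal ((\<Sum>Q\<in>I. c Q * indicator Q x) powr p) * ennreal (w x) \<partial>lebesgue)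
    = ennreal (\<Sum>P\<in>I. (\<Sum>Q | Q \<in> I \<and> P \<subseteq> Q. c Q) powr p * atom_weight w P)"
  unfolding sum_indicator_eq_step step_powr[OF assms(2)] using assms
  by (intro nn_integral_step) auto

end

end

text \<open>Jensen's inequality for the convex function \<open>s \<mapsto> s\<^sup>p\<close>,
obtained by integrating its tangent at the mean \<open>t\<close>; the tangent inequality is an
instance of Young's. It shows that averaging \<open>f\<close> over the atoms does not increase
its norm. If \<open>A\<close> has \<open>w\<close>-measure 0, the mean \<open>t\<close> is 0 by
the convention for division, and both conclusions remain true because \<open>f w\<close>
vanishes almost everywhere on \<open>A\<close>.\<close>

lemma weighted_jensen:
  fixes f w :: "real ^ 'n \<Rightarrow> real" and p :: real
  assumes p: "1 < p" and w: "\<And>x. 0 \<le> w x" and f: "\<And>x. 0 \<le> f x"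
    and int_w: "set_integrable lebesgue A w"
    and int_fw: "set_integrable lebesgue A (\<lambda>x. f x * w x)"
    and int_fpw: "set_integrable lebesgue A (\<lambda>x. f x powr p * w x)"
  defines "t \<equiv> weight_measure (\<lambda>x. f x * w x) A / weight_measure w A"
  shows "t powr p * weight_measure w A \<le> weight_measure (\<lambda>x. f x powr p * w x) A"
    and "t * weight_measure w A = weight_measure (\<lambda>x. f x * w x) A"
proof -
  have t0: "0 \<le> t"
    unfolding t_def using f w by (intro divide_nonneg_nonneg weight_measure_nonneg) auto
  show tw: "t * weight_measure w A = weight_measure (\<lambda>x. f x * w x) A"
  proof (cases "weight_measure w A = 0")
    case True
    have "(\<integral>x. indicator A x *\<^sub>R w x \<partial>lebesgue) = 0"
      using True by (simp add: weight_measure_def set_lebesgue_integral_def)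
    then have "AE x in lebesgue. indicator A x *\<^sub>R w x = 0"
      using int_w w by (subst (asm) integral_nonneg_eq_0_iff_AE) (auto simp: set_integrable_def)
    then have "(\<integral>x. indicator A x *\<^sub>R (f x * w x) \<partial>lebesgue) = 0"
      by (intro integral_eq_zero_AE) (auto elim!: eventually_mono)
    then show ?thesis using True by (simp add: weight_measure_def set_lebesgue_integral_def)
  qed (simp add: t_def)
  define q where "q = p / (p - 1)"
  have pq: "1 / p + 1 / q = 1" using p by (simp add: q_def field_simps)
  note q = conjugate_exponent[OF p pq]
  have tangent: "p * t powr (p - 1) * f x \<le> f x powr p + (p - 1) * t powr p" for x
  proof -
    have "f x * t powr (p - 1) \<le> f x powr p / p + (t powr (p - 1)) powr q / q"
      using p q pq f by (intro Youngs_inequality) auto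
    also have "\<dots> = (f x powr p + (p - 1) * t powr p) / p"
    proof -
      have "X / q = (p - 1) * X / p" for X using p by (simp add: q_def)
      then show ?thesis
        unfolding powr_powr q(2) by (simp add: add_divide_distrib)
    qed
    finally show ?thesis using p by (simp add: field_simps)
  qed
  have "p * t powr (p - 1) * weight_measure (\<lambda>x. f x * w x) A
      = (LINT x:A|lebesgue. p * t powr (p - 1) * (f x * w x))"
    by (simp add: weight_measure_def)
  also have "\<dots> \<le> (LINT x:A|lebesgue. f x powr p * w x + (p - 1) * t powr p * w x)"
  proof (rule set_integral_mono)
    show "p * t powr (p - 1) * (f x * w x) \<le> f x powr p * w x + (p - 1) * t powr p * w x" for x
      using mult_right_mono[OF tangent[of x] w[of x]] by (simp add: algebra_simps)
  qed (use int_w int_fw int_fpw in \<open>auto intro!: set_integral_add\<close>)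
  also have "\<dots> = weight_measure (\<lambda>x. f x powr p * w x) A + (p - 1) * t powr p * weight_measure w A"
    using int_w int_fpw by (subst set_integral_add) (auto simp: weight_measure_def)
  also have "p * t powr (p - 1) * weight_measure (\<lambda>x. f x * w x) A = p * (t powr p * weight_measure w A)"
  proof -
    have "t powr (p - 1) * t = t powr p"
      using t0 p powr_add[of t "p - 1" 1] by (cases "t = 0") auto
    then show ?thesis unfolding tw[symmetric] by (metis mult.assoc)
  qed
  finally show "t powr p * weight_measure w A \<le> weight_measure (\<lambda>x. f x powr p * w x) A"
    by (simp add: algebra_simps)
qed

section \<open>Reduction of the operator inequalities to finite forests\<close>

definition normalized_coeff :: "((real ^ 'n) set \<Rightarrow> real) \<Rightarrow> (real ^ 'n) set \<Rightarrow> real" where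
  "normalized_coeff lam Q = lam Q / measure lebesgue Q"

lemma normalized_coeff_nonneg: "0 \<le> lam Q \<Longrightarrow> 0 \<le> normalized_coeff lam Q"
  by (simp add: normalized_coeff_def)

lemma T_seq_eq: "T_seq lam \<phi> x Q = normalized_coeff lam Q * weight_measure \<phi> Q * indicator Q x"
  by (simp add: T_seq_def average_def normalized_coeff_def weight_measure_def)

lemma abs_T_seq_eq:
  assumes "0 \<le> lam Q" "\<And>x. 0 \<le> \<phi> x"
  shows "\<bar>T_seq lam \<phi> x Q\<bar> = normalized_coeff lam Q * weight_measure \<phi> Q * indicator Q x"
  using normalized_coeff_nonneg[of lam Q] assms(1) weight_measure_nonneg[of \<phi> Q] assms(2)
  by (simp add: T_seq_eq abs_mult)

lemma S_op_eq:
  assumes "\<And>Q. Q \<in> dyadic_cubes \<Longrightarrow> 0 \<le> lam Q" "\<And>x. 0 \<le> \<phi> x"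
  shows "S_op lam \<phi> x = (\<Sum>\<^sub>\<infinity>Q\<in>dyadic_cubes.
    ennreal (normalized_coeff lam Q * weight_measure \<phi> Q * indicator Q x))"
  unfolding S_op_def using assms by (intro infsum_cong) (simp add: abs_T_seq_eq)

lemma S_loc_eq:
  assumes "\<And>Q. Q \<in> dyadic_cubes \<Longrightarrow> 0 \<le> lam Q" "\<And>x. 0 \<le> \<phi> x"
  shows "S_loc lam R \<phi> x = (\<Sum>\<^sub>\<infinity>Q\<in>{Q \<in> dyadic_cubes. Q \<subseteq> R}.
    ennreal (normalized_coeff lam Q * weight_measure \<phi> Q * indicator Q x))"
  unfolding S_loc_def using assms by (intro infsum_cong) (simp add: abs_T_seq_eq)

lemma weight_measure_abs_le: "\<bar>weight_measure \<phi> Q\<bar> \<le> weight_measure (\<lambda>x. \<bar>\<phi> x\<bar>) Q"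
proof -
  have "\<bar>weight_measure \<phi> Q\<bar> \<le> (\<integral>x. \<bar>indicator Q x *\<^sub>R \<phi> x\<bar> \<partial>lebesgue)"
    unfolding weight_measure_def set_lebesgue_integral_def by (rule integral_abs_bound)
  also have "\<dots> = weight_measure (\<lambda>x. \<bar>\<phi> x\<bar>) Q"
    unfolding weight_measure_def set_lebesgue_integral_def by (simp add: abs_mult)
  finally show ?thesis .
qed

lemma S_op_le_S_op_abs:
  fixes lam :: "(real ^ 'n) set \<Rightarrow> real" and \<phi> :: "real ^ 'n \<Rightarrow> real"
  assumes "\<And>Q. Q \<in> dyadic_cubes \<Longrightarrow> 0 \<le> lam Q"
  shows "S_op lam \<phi> x \<le> S_op lam (\<lambda>x. \<bar>\<phi> x\<bar>) x"
  unfolding S_op_def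
proof (rule infsum_mono)
  fix Q :: "(real ^ 'n) set" assume Q: "Q \<in> dyadic_cubes"
  show "ennreal \<bar>T_seq lam \<phi> x Q\<bar> \<le> ennreal \<bar>T_seq lam (\<lambda>x. \<bar>\<phi> x\<bar>) x Q\<bar>"
    using normalized_coeff_nonneg[of lam Q] assms[OF Q] weight_measure_abs_le[of \<phi> Q]
    by (auto simp: T_seq_eq abs_mult intro!: ennreal_leI mult_left_mono mult_right_mono)
qed (auto intro: nonneg_summable_on_complete)

context dyadic_family
begin

lemma atom_integrable: "locally_integrable w \<Longrightarrow> P \<in> I \<Longrightarrow> set_integrable lebesgue (atom P) w"
  using dyadic by (intro locally_integrable_cube[of w P]) (auto simp: sets_atom atom_subset)

lemma step_measurable: "step v \<in> borel_measurable lebesgue"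
  unfolding step_def[abs_def]
  by (intro borel_measurable_sum borel_measurable_times borel_measurable_const
      borel_measurable_indicator sets_atom)

text \<open>A function on the forest is the step function of an element of
\<open>L\<^sup>p(\<sigma>)\<close> with the same norm, and the sum over the finite family is
dominated by \<open>S\<close>.\<close>

lemma strong_type_if_Lp_bounded:
  assumes p: "1 < p" and C: "0 \<le> C"
    and lam: "\<And>Q. Q \<in> dyadic_cubes \<Longrightarrow> 0 \<le> lam Q"
    and \<sigma>: "locally_integrable \<sigma>" "\<And>x. 0 \<le> \<sigma> x"
    and \<omega>: "locally_integrable \<omega>" "\<And>x. 0 \<le> \<omega> x"
    and bounded: "\<And>f. f \<in> Lp_space p \<sigma> \<Longrightarrow>
      Lp_norm p \<omega> (S_op lam (\<lambda>x. f x * \<sigma> x)) \<le> ennreal C * Lp_norm p \<sigma> (\<lambda>x. ennreal \<bar>f x\<bar>)"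
  shows "strong_type p (normalized_coeff lam) (atom_weight \<sigma>) (atom_weight \<omega>) (C powr p)"
  unfolding strong_type_def
proof (intro allI impI)
  fix v :: "(real ^ 'n) set \<Rightarrow> real" assume "\<forall>P\<in>I. 0 \<le> v P"
  then have v: "\<And>P. P \<in> I \<Longrightarrow> 0 \<le> v P" by simp
  note \<sigma>_atom = atom_integrable[OF \<sigma>(1)] and \<omega>_atom = atom_integrable[OF \<omega>(1)]
  define F where "F = (\<Sum>P\<in>I. v P powr p * atom_weight \<sigma> P)"
  have F: "0 \<le> F"
    using \<sigma>(2) by (auto simp: F_def intro!: sum_nonneg mult_nonneg_nonneg weight_measure_nonneg)
  have "(\<integral>\<^sup>+ x. epowr (ennreal \<bar>step v x\<bar>) p * ennreal (\<sigma> x) \<partial>lebesgue)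
      = (\<integral>\<^sup>+ x. ennreal (step (\<lambda>P. v P powr p) x) * ennreal (\<sigma> x) \<partial>lebesgue)"
    using p step_nonneg[OF v] by (simp add: epowr_ennreal step_powr)
  also have "\<dots> = ennreal F"
    unfolding F_def using \<sigma> by (intro nn_integral_step \<sigma>_atom) auto
  finally have norm: "Lp_norm p \<sigma> (\<lambda>x. ennreal \<bar>step v x\<bar>) = ennreal (F powr (1 / p))"
    unfolding Lp_norm_def using F by (simp add: epowr_ennreal)
  then have "step v \<in> Lp_space p \<sigma>"
    by (simp add: Lp_space_def step_measurable)
  from bounded[OF this] have "Lp_norm p \<omega> (S_op lam (\<lambda>x. step v x * \<sigma> x)) \<le> ennreal (C * F powr (1 / p))"
    unfolding norm using C by (simp add: ennreal_mult)
  moreover have "(C * F powr (1 / p)) powr p = C powr p * F"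
    using p C F by (simp add: powr_mult powr_powr)
  ultimately have "(\<integral>\<^sup>+ x. epowr (S_op lam (\<lambda>x. step v x * \<sigma> x) x) p * ennreal (\<omega> x) \<partial>lebesgue)
      \<le> ennreal (C powr p * F)"
    using p C by (subst (asm) Lp_norm_le_iff) auto
  moreover have fs: "0 \<le> step v x * \<sigma> x" for x using step_nonneg[OF v] \<sigma>(2) by simp
  define c where "c Q = normalized_coeff lam Q * weight_measure (\<lambda>x. step v x * \<sigma> x) Q" for Q
  have c: "0 \<le> c Q" if "Q \<in> dyadic_cubes" for Q
    unfolding c_def using normalized_coeff_nonneg[of lam Q] lam[OF that]
      weight_measure_nonneg[of "\<lambda>x. step v x * \<sigma> x" Q] fs
    by simp
  have S_eq: "S_op lam (\<lambda>x. step v x * \<sigma> x) x = (\<Sum>\<^sub>\<infinity>Q\<in>dyadic_cubes. ennreal (c Q * indicator Q x))" for x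
    unfolding c_def using lam fs by (intro S_op_eq)
  ultimately have "(\<integral>\<^sup>+ x. ennreal ((\<Sum>Q\<in>I. c Q * indicator Q x) powr p) * ennreal (\<omega> x) \<partial>lebesgue)
      \<le> ennreal (C powr p * F)"
    unfolding S_eq using finite_family dyadic p c \<omega>(1)
    by (subst (asm) nn_integral_epowr_infsum_le_iff) (auto simp: locally_integrable_def)
  also have "(\<integral>\<^sup>+ x. ennreal ((\<Sum>Q\<in>I. c Q * indicator Q x) powr p) * ennreal (\<omega> x) \<partial>lebesgue)
      = ennreal (\<Sum>P\<in>I. (\<Sum>Q | Q \<in> I \<and> P \<subseteq> Q. c Q) powr p * atom_weight \<omega> P)"
    using p \<omega>(2) by (intro nn_integral_sum_indicator_powr \<omega>_atom) auto
  also have "(\<Sum>P\<in>I. (\<Sum>Q | Q \<in> I \<and> P \<subseteq> Q. c Q) powr p * atom_weight \<omega> P)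
      = (\<Sum>P\<in>I. (\<Sum>Q | Q \<in> I \<and> P \<subseteq> Q. normalized_coeff lam Q *
        mass (\<lambda>P. v P * atom_weight \<sigma> P) Q) powr p * atom_weight \<omega> P)"
    by (intro sum.cong refl arg_cong2[of _ _ _ _ "(*)"] arg_cong2[of _ _ _ _ "(powr)"])
      (auto simp: c_def intro!: weight_measure_step \<sigma>_atom)
  finally show "(\<Sum>P\<in>I. (\<Sum>Q | Q \<in> I \<and> P \<subseteq> Q. normalized_coeff lam Q *
        mass (\<lambda>P. v P * atom_weight \<sigma> P) Q) powr p * atom_weight \<omega> P)
      \<le> C powr p * (\<Sum>P\<in>I. v P powr p * atom_weight \<sigma> P)"
    using F by (simp add: F_def)
qed

text \<open>The cubes of the family inside \<open>R\<close> form a finite subfamily of those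
defining \<open>S\<^sub>R\<close>. To evaluate the integral on the atoms of the whole family,
the remaining cubes are kept with coefficient 0.\<close>

lemma testing_if_Lp_testing:
  assumes p: "1 < p" and C: "0 \<le> C"
    and lam: "\<And>Q. Q \<in> dyadic_cubes \<Longrightarrow> 0 \<le> lam Q"
    and \<sigma>: "locally_integrable \<sigma>" "\<And>x. 0 \<le> \<sigma> x"
    and \<omega>: "locally_integrable \<omega>" "\<And>x. 0 \<le> \<omega> x"
    and bounded: "\<And>R. R \<in> dyadic_cubes \<Longrightarrow>
      Lp_norm p \<omega> (S_loc lam R \<sigma>) \<le> ennreal (C * weight_measure \<sigma> R powr (1 / p))"
  shows "testing p (normalized_coeff lam) (atom_weight \<sigma>) (atom_weight \<omega>) (C powr p)"
  unfolding testing_def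
proof
  fix R assume R: "R \<in> I"
  note \<sigma>_atom = atom_integrable[OF \<sigma>(1)] and \<omega>_atom = atom_integrable[OF \<omega>(1)]
  define c where "c Q = normalized_coeff lam Q * weight_measure \<sigma> Q" for Q
  have c: "0 \<le> c Q" if "Q \<in> dyadic_cubes" for Q
    using that lam \<sigma>(2)
    by (auto simp: c_def intro!: mult_nonneg_nonneg normalized_coeff_nonneg weight_measure_nonneg)
  have \<sigma>R: "0 \<le> weight_measure \<sigma> R" using \<sigma>(2) by (rule weight_measure_nonneg)
  have S_eq: "S_loc lam R \<sigma> x = (\<Sum>\<^sub>\<infinity>Q\<in>{Q \<in> dyadic_cubes. Q \<subseteq> R}. ennreal (c Q * indicator Q x))" for x
    unfolding c_def using lam \<sigma>(2) by (intro S_loc_eq)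
  have "(C * weight_measure \<sigma> R powr (1 / p)) powr p = C powr p * weight_measure \<sigma> R"
    using p C \<sigma>R by (simp add: powr_mult powr_powr)
  moreover have "Lp_norm p \<omega> (S_loc lam R \<sigma>) \<le> ennreal (C * weight_measure \<sigma> R powr (1 / p))"
    using bounded R dyadic by blast
  ultimately have "(\<integral>\<^sup>+ x. epowr (S_loc lam R \<sigma> x) p * ennreal (\<omega> x) \<partial>lebesgue)
      \<le> ennreal (C powr p * weight_measure \<sigma> R)"
    using p C by (subst (asm) Lp_norm_le_iff) auto
  then have all_J: "\<forall>J. finite J \<and> J \<subseteq> {Q \<in> dyadic_cubes. Q \<subseteq> R} \<longrightarrow>
      (\<integral>\<^sup>+ x. ennreal ((\<Sum>Q\<in>J. c Q * indicator Q x) powr p) * ennreal (\<omega> x) \<partial>lebesgue)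
      \<le> ennreal (C powr p * weight_measure \<sigma> R)"
    unfolding S_eq using p c \<omega>(1)
    by (subst (asm) nn_integral_epowr_infsum_le_iff) (simp_all add: locally_integrable_def)
  have "below R \<subseteq> {Q \<in> dyadic_cubes. Q \<subseteq> R}"
    using dyadic by (auto simp: below_def)
  then have "(\<integral>\<^sup>+ x. ennreal ((\<Sum>Q\<in>below R. c Q * indicator Q x) powr p) * ennreal (\<omega> x) \<partial>lebesgue)
      \<le> ennreal (C powr p * weight_measure \<sigma> R)"
    by (intro all_J[rule_format] conjI finite_below)
  also have "(\<integral>\<^sup>+ x. ennreal ((\<Sum>Q\<in>below R. c Q * indicator Q x) powr p) * ennreal (\<omega> x) \<partial>lebesgue)
      = (\<integral>\<^sup>+ x. ennreal ((\<Sum>Q\<in>I. (of_bool (Q \<subseteq> R) * c Q) * indicator Q x) powr p) * ennreal (\<omega> x) \<partial>lebesgue)"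
  proof -
    have "(\<Sum>Q\<in>below R. c Q * indicator Q x) = (\<Sum>Q\<in>I. (of_bool (Q \<subseteq> R) * c Q) * indicator Q x)" for x
      using finite_family by (intro sum.mono_neutral_cong_left) (auto simp: below_def)
    then show ?thesis by simp
  qed
  also have "\<dots> = ennreal (\<Sum>P\<in>I. (\<Sum>Q | Q \<in> I \<and> P \<subseteq> Q. of_bool (Q \<subseteq> R) * c Q) powr p * atom_weight \<omega> P)"
    using p \<omega>(2) by (intro nn_integral_sum_indicator_powr \<omega>_atom) auto
  finally have "(\<Sum>P\<in>I. (\<Sum>Q | Q \<in> I \<and> P \<subseteq> Q. of_bool (Q \<subseteq> R) * c Q) powr p * atom_weight \<omega> P)
      \<le> C powr p * weight_measure \<sigma> R"
    using \<sigma>R by simp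
  moreover have "(\<Sum>P\<in>below R. (\<Sum>Q | Q \<in> I \<and> P \<subseteq> Q. of_bool (Q \<subseteq> R) * c Q) powr p * atom_weight \<omega> P)
      \<le> (\<Sum>P\<in>I. (\<Sum>Q | Q \<in> I \<and> P \<subseteq> Q. of_bool (Q \<subseteq> R) * c Q) powr p * atom_weight \<omega> P)"
    using finite_family below_subset \<omega>(2)
    by (intro sum_mono2) (auto intro!: mult_nonneg_nonneg weight_measure_nonneg)
  moreover have "(\<Sum>Q | Q \<in> I \<and> P \<subseteq> Q. of_bool (Q \<subseteq> R) * c Q)
      = (\<Sum>Q | Q \<in> I \<and> P \<subseteq> Q \<and> Q \<subseteq> R. normalized_coeff lam Q * mass (atom_weight \<sigma>) Q)" for P
    using finite_family weight_measure_eq_mass[OF \<sigma>_atom]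
    by (intro sum.mono_neutral_cong_right) (auto simp: c_def)
  moreover have "weight_measure \<sigma> R = mass (atom_weight \<sigma>) R"
    using R by (intro weight_measure_eq_mass \<sigma>_atom)
  ultimately show "(\<Sum>P\<in>below R. (\<Sum>Q | Q \<in> I \<and> P \<subseteq> Q \<and> Q \<subseteq> R.
        normalized_coeff lam Q * mass (atom_weight \<sigma>) Q) powr p * atom_weight \<omega> P)
      \<le> C powr p * mass (atom_weight \<sigma>) R"
    by simp
qed

end

text \<open>Adding \<open>R\<close> to a finite family of cubes inside \<open>R\<close> only
increases the sum, and makes the testing condition of the enlarged family at its largest element
\<open>R\<close> the desired bound.\<close>

lemma Lp_testing_if_testing:
  fixes \<sigma> \<omega> :: "real ^ 'n \<Rightarrow> real"
  assumes p: "1 < p" and D: "0 \<le> D"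
    and lam: "\<And>Q. Q \<in> dyadic_cubes \<Longrightarrow> 0 \<le> lam Q"
    and \<sigma>: "locally_integrable \<sigma>" "\<And>x. 0 \<le> \<sigma> x"
    and \<omega>: "locally_integrable \<omega>" "\<And>x. 0 \<le> \<omega> x"
    and testing: "\<And>I. dyadic_family I \<Longrightarrow> finite_forest.testing I p (normalized_coeff lam)
      (\<lambda>P. weight_measure \<sigma> (dyadic_family.atom I P)) (\<lambda>P. weight_measure \<omega> (dyadic_family.atom I P)) D"
    and R: "R \<in> dyadic_cubes"
  shows "Lp_norm p \<omega> (S_loc lam R \<sigma>) \<le> ennreal (D powr (1 / p) * weight_measure \<sigma> R powr (1 / p))"
proof -
  define c where "c Q = normalized_coeff lam Q * weight_measure \<sigma> Q" for Q
  have c: "0 \<le> c Q" if "Q \<in> dyadic_cubes" for Q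
    using that lam \<sigma>(2)
    by (auto simp: c_def intro!: mult_nonneg_nonneg normalized_coeff_nonneg weight_measure_nonneg)
  have \<sigma>R: "0 \<le> weight_measure \<sigma> R" using \<sigma>(2) by (rule weight_measure_nonneg)
  have S_eq: "S_loc lam R \<sigma> x = (\<Sum>\<^sub>\<infinity>Q\<in>{Q \<in> dyadic_cubes. Q \<subseteq> R}. ennreal (c Q * indicator Q x))" for x
    unfolding c_def using lam \<sigma>(2) by (intro S_loc_eq)
  have finite_bound: "(\<integral>\<^sup>+ x. ennreal ((\<Sum>Q\<in>J. c Q * indicator Q x) powr p) * ennreal (\<omega> x) \<partial>lebesgue)
      \<le> ennreal (D * weight_measure \<sigma> R)"
    if J: "finite J \<and> J \<subseteq> {Q \<in> dyadic_cubes. Q \<subseteq> R}" for J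
  proof -
    define I where "I = insert R J"
    interpret dyadic_family I
      using J R by unfold_locales (auto simp: I_def)
    have RI: "R \<in> I" by (simp add: I_def)
    have IR: "Q \<subseteq> R" if "Q \<in> I" for Q using that J by (auto simp: I_def)
    have below_R: "below R = I" using IR by (auto simp: below_def)
    note \<sigma>_atom = atom_integrable[OF \<sigma>(1)] and \<omega>_atom = atom_integrable[OF \<omega>(1)]
    have "(\<integral>\<^sup>+ x. ennreal ((\<Sum>Q\<in>J. c Q * indicator Q x) powr p) * ennreal (\<omega> x) \<partial>lebesgue)
      \<le> (\<integral>\<^sup>+ x. ennreal ((\<Sum>Q\<in>I. c Q * indicator Q x) powr p) * ennreal (\<omega> x) \<partial>lebesgue)"
    proof (intro nn_integral_mono mult_right_mono ennreal_leI powr_mono2)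
      fix x
      show "(\<Sum>Q\<in>J. c Q * indicator Q x) \<le> (\<Sum>Q\<in>I. c Q * indicator Q x)"
        using J R c by (intro sum_mono2) (auto simp: I_def)
      show "0 \<le> (\<Sum>Q\<in>J. c Q * indicator Q x)"
        using J c by (auto intro!: sum_nonneg)
    qed (use p in auto)
    also have "\<dots> = ennreal (\<Sum>P\<in>I. (\<Sum>Q | Q \<in> I \<and> P \<subseteq> Q. c Q) powr p * atom_weight \<omega> P)"
      using p \<omega>(2) by (intro nn_integral_sum_indicator_powr \<omega>_atom) auto
    also have "(\<Sum>P\<in>I. (\<Sum>Q | Q \<in> I \<and> P \<subseteq> Q. c Q) powr p * atom_weight \<omega> P)
        = (\<Sum>P\<in>below R. (\<Sum>Q | Q \<in> I \<and> P \<subseteq> Q \<and> Q \<subseteq> R.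
            normalized_coeff lam Q * mass (atom_weight \<sigma>) Q) powr p * atom_weight \<omega> P)"
      unfolding below_R using IR weight_measure_eq_mass[OF \<sigma>_atom]
      by (intro sum.cong refl arg_cong2[of _ _ _ _ "(*)"] arg_cong2[of _ _ _ _ "(powr)"])
        (auto simp: c_def)
    also have "\<dots> \<le> D * mass (atom_weight \<sigma>) R"
      using testing[OF dyadic_family_axioms] RI by (simp add: testing_def)
    also have "mass (atom_weight \<sigma>) R = weight_measure \<sigma> R"
      using RI by (intro weight_measure_eq_mass[symmetric] \<sigma>_atom)
    finally show ?thesis by (simp add: ennreal_leI)
  qed
  have "(D powr (1 / p) * weight_measure \<sigma> R powr (1 / p)) powr p = D * weight_measure \<sigma> R"
    using p D \<sigma>R by (simp add: powr_mult powr_powr)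
  moreover have "(\<integral>\<^sup>+ x. epowr (S_loc lam R \<sigma> x) p * ennreal (\<omega> x) \<partial>lebesgue) \<le> ennreal (D * weight_measure \<sigma> R)"
    unfolding S_eq using p c \<omega>(1) finite_bound
    by (subst nn_integral_epowr_infsum_le_iff) (auto simp: locally_integrable_def)
  ultimately show ?thesis
    using p by (subst Lp_norm_le_iff) auto
qed

text \<open>\<open>S(f\<sigma>)\<close> is dominated by \<open>S(|f|\<sigma>)\<close>, which
depends on \<open>|f|\<close> only through the integrals of \<open>|f|\<sigma>\<close> over
cubes. For the cubes of a finite family these do not change if \<open>|f|\<close> is replaced by
its means over the atoms, and by Jensen's inequality the norm does not increase.\<close>

lemma Lp_bounded_if_strong_type:
  fixes \<sigma> \<omega> :: "real ^ 'n \<Rightarrow> real"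
  assumes p: "1 < p" and D: "0 \<le> D"
    and lam: "\<And>Q. Q \<in> dyadic_cubes \<Longrightarrow> 0 \<le> lam Q"
    and \<sigma>: "locally_integrable \<sigma>" "\<And>x. 0 \<le> \<sigma> x"
    and \<omega>: "locally_integrable \<omega>" "\<And>x. 0 \<le> \<omega> x"
    and strong: "\<And>I. dyadic_family I \<Longrightarrow> finite_forest.strong_type I p (normalized_coeff lam)
      (\<lambda>P. weight_measure \<sigma> (dyadic_family.atom I P)) (\<lambda>P. weight_measure \<omega> (dyadic_family.atom I P)) D"
    and f: "f \<in> Lp_space p \<sigma>"
  shows "Lp_norm p \<omega> (S_op lam (\<lambda>x. f x * \<sigma> x))
    \<le> ennreal (D powr (1 / p)) * Lp_norm p \<sigma> (\<lambda>x. ennreal \<bar>f x\<bar>)"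
proof -
  define fp where "fp x = \<bar>f x\<bar> powr p * \<sigma> x" for x
  define fs where "fs x = \<bar>f x\<bar> * \<sigma> x" for x
  have fp0: "0 \<le> fp x" and fs0: "0 \<le> fs x" for x using \<sigma>(2) by (auto simp: fp_def fs_def)
  have [measurable]: "f \<in> borel_measurable lebesgue" "\<sigma> \<in> borel_measurable lebesgue"
    using f \<sigma>(1) by (auto simp: Lp_space_def locally_integrable_def)
  have nn_fp: "(\<integral>\<^sup>+ x. epowr (ennreal \<bar>f x\<bar>) p * ennreal (\<sigma> x) \<partial>lebesgue) = (\<integral>\<^sup>+ x. ennreal (fp x) \<partial>lebesgue)"
    by (simp add: epowr_ennreal fp_def ennreal_mult \<sigma>(2))
  have "(\<integral>\<^sup>+ x. ennreal (fp x) \<partial>lebesgue) \<noteq> \<infinity>"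
  proof -
    have "Lp_norm p \<sigma> (\<lambda>x. ennreal \<bar>f x\<bar>) < \<infinity>" using f by (simp add: Lp_space_def)
    then show ?thesis unfolding Lp_norm_def nn_fp by (auto simp: epowr_def)
  qed
  then have int_fp: "integrable lebesgue fp"
    using fp0 by (intro integrableI_nonneg) (auto simp: fp_def[abs_def] less_top)
  define F where "F = (\<integral>x. fp x \<partial>lebesgue)"
  have F: "0 \<le> F" unfolding F_def using fp0 by (intro integral_nonneg_AE) auto
  have norm_f: "Lp_norm p \<sigma> (\<lambda>x. ennreal \<bar>f x\<bar>) = ennreal (F powr (1 / p))"
    unfolding Lp_norm_def nn_fp F_def using fp0 int_fp F
    by (subst nn_integral_eq_integral) (auto simp: epowr_ennreal F_def)
  \<comment> \<open>by \<open>|f| \<le> 1 + |f|\<^sup>p\<close>, the integrals of \<open>f\<sigma>\<close> over cubes are finite\<close>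
  have int_fs: "set_integrable lebesgue A fs"
    if A: "A \<subseteq> Q" "Q \<in> dyadic_cubes" "A \<in> sets lebesgue" for A Q
    unfolding set_integrable_def
  proof (rule Bochner_Integration.integrable_bound)
    show "integrable lebesgue (\<lambda>x. indicator A x *\<^sub>R \<sigma> x + fp x)"
      using locally_integrable_cube[OF \<sigma>(1) A(2,1,3)] int_fp by (simp add: set_integrable_def)
    show "(\<lambda>x. indicator A x *\<^sub>R fs x) \<in> borel_measurable lebesgue"
      using A(3) unfolding fs_def[abs_def] by measurable
    have "indicator A x * fs x \<le> indicator A x * \<sigma> x + fp x" for x
    proof -
      have "\<bar>f x\<bar> \<le> 1 + \<bar>f x\<bar> powr p"
      proof (cases "\<bar>f x\<bar> \<le> 1")
        case False
        then have "\<bar>f x\<bar> powr 1 \<le> \<bar>f x\<bar> powr p" using p by (intro powr_mono) auto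
        then show ?thesis using False by simp
      qed (simp add: add_increasing2)
      from mult_right_mono[OF this \<sigma>(2)[of x]] show ?thesis
        using fp0[of x] by (auto simp: indicator_def fs_def fp_def algebra_simps)
    qed
    then show "AE x in lebesgue. norm (indicator A x *\<^sub>R fs x) \<le> norm (indicator A x *\<^sub>R \<sigma> x + fp x)"
      using fp0 fs0 \<sigma>(2) by (auto simp: abs_mult)
  qed
  define c where "c Q = normalized_coeff lam Q * weight_measure fs Q" for Q
  have c: "0 \<le> c Q" if "Q \<in> dyadic_cubes" for Q
    using that lam fs0
    by (auto simp: c_def intro!: mult_nonneg_nonneg normalized_coeff_nonneg weight_measure_nonneg)
  have S_eq: "S_op lam fs x = (\<Sum>\<^sub>\<infinity>Q\<in>dyadic_cubes. ennreal (c Q * indicator Q x))" for x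
    unfolding c_def using lam fs0 by (intro S_op_eq)
  have finite_bound: "(\<integral>\<^sup>+ x. ennreal ((\<Sum>Q\<in>I. c Q * indicator Q x) powr p) * ennreal (\<omega> x) \<partial>lebesgue)
      \<le> ennreal (D * F)"
    if I: "finite I \<and> I \<subseteq> dyadic_cubes" for I
  proof -
    interpret dyadic_family I using I by unfold_locales auto
    note \<sigma>_atom = atom_integrable[OF \<sigma>(1)] and \<omega>_atom = atom_integrable[OF \<omega>(1)]
    have fs_atom: "set_integrable lebesgue (atom P) fs" if "P \<in> I" for P
      using that dyadic by (intro int_fs[of _ P]) (auto simp: sets_atom atom_subset)
    have fp_atom: "set_integrable lebesgue (atom P) fp" if "P \<in> I" for P
      unfolding set_integrable_def using int_fp sets_atom[OF that]
      by (rule integrable_mult_indicator[rotated])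
    define v where "v P = atom_weight fs P / atom_weight \<sigma> P" for P
    have v0: "0 \<le> v P" for P
      unfolding v_def using fs0 \<sigma>(2) by (intro divide_nonneg_nonneg weight_measure_nonneg) auto
    have v_\<sigma>: "v P * atom_weight \<sigma> P = atom_weight fs P"
      and v_p: "v P powr p * atom_weight \<sigma> P \<le> atom_weight fp P" if P: "P \<in> I" for P
      using weighted_jensen[of p \<sigma> "\<lambda>x. \<bar>f x\<bar>" "atom P"] p \<sigma>(2) \<sigma>_atom[OF P] fs_atom[OF P] fp_atom[OF P]
      by (auto simp: v_def fs_def[abs_def] fp_def[abs_def])
    have "(\<integral>\<^sup>+ x. ennreal ((\<Sum>Q\<in>I. c Q * indicator Q x) powr p) * ennreal (\<omega> x) \<partial>lebesgue)
        = ennreal (\<Sum>P\<in>I. (\<Sum>Q | Q \<in> I \<and> P \<subseteq> Q. c Q) powr p * atom_weight \<omega> P)"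
      using p \<omega>(2) by (intro nn_integral_sum_indicator_powr \<omega>_atom) auto
    also have "(\<Sum>P\<in>I. (\<Sum>Q | Q \<in> I \<and> P \<subseteq> Q. c Q) powr p * atom_weight \<omega> P)
        = (\<Sum>P\<in>I. (\<Sum>Q | Q \<in> I \<and> P \<subseteq> Q. normalized_coeff lam Q *
            mass (\<lambda>P. v P * atom_weight \<sigma> P) Q) powr p * atom_weight \<omega> P)"
    proof -
      have "mass (\<lambda>P. v P * atom_weight \<sigma> P) Q = weight_measure fs Q" if "Q \<in> I" for Q
      proof -
        have "mass (\<lambda>P. v P * atom_weight \<sigma> P) Q = mass (atom_weight fs) Q"
          unfolding mass_def using v_\<sigma> below_subset by (intro sum.cong) auto
        then show ?thesis using weight_measure_eq_mass[OF fs_atom that] by simp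
      qed
      then show ?thesis
        by (intro sum.cong refl arg_cong2[of _ _ _ _ "(*)"] arg_cong2[of _ _ _ _ "(powr)"])
          (auto simp: c_def)
    qed
    also have "\<dots> \<le> D * (\<Sum>P\<in>I. v P powr p * atom_weight \<sigma> P)"
      using strong[OF dyadic_family_axioms] v0 by (simp add: strong_type_def)
    also have "\<dots> \<le> D * F"
    proof (rule mult_left_mono[OF _ D])
      have "(\<Sum>P\<in>I. v P powr p * atom_weight \<sigma> P) \<le> (\<Sum>P\<in>I. 1 * atom_weight fp P)"
        using v_p by (intro sum_mono) simp
      also have "\<dots> = (\<integral>x. step (\<lambda>_. 1) x * fp x \<partial>lebesgue)"
        using fp_atom by (rule integral_step(2)[symmetric])
      also have "\<dots> \<le> F"
        unfolding F_def
      proof (intro integral_mono integral_step(1) fp_atom int_fp)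
        show "step (\<lambda>_. 1) x * fp x \<le> fp x" for x
          using fp0[of x] by (cases x rule: step_cases) auto
      qed
      finally show "(\<Sum>P\<in>I. v P powr p * atom_weight \<sigma> P) \<le> F" .
    qed
    finally show ?thesis by (simp add: ennreal_leI)
  qed
  have abs_fs: "\<bar>f x * \<sigma> x\<bar> = fs x" for x using \<sigma>(2) by (simp add: fs_def abs_mult)
  have "(\<integral>\<^sup>+ x. epowr (S_op lam (\<lambda>x. f x * \<sigma> x) x) p * ennreal (\<omega> x) \<partial>lebesgue)
      \<le> (\<integral>\<^sup>+ x. epowr (S_op lam fs x) p * ennreal (\<omega> x) \<partial>lebesgue)"
    using S_op_le_S_op_abs[of lam "\<lambda>x. f x * \<sigma> x"] lam p unfolding abs_fs
    by (intro nn_integral_mono mult_right_mono epowr_mono) auto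
  also have "\<dots> \<le> ennreal (D * F)"
    unfolding S_eq using p c \<omega>(1) finite_bound
    by (subst nn_integral_epowr_infsum_le_iff) (auto simp: locally_integrable_def)
  also have "D * F = (D powr (1 / p) * F powr (1 / p)) powr p"
    using p D F by (simp add: powr_mult powr_powr)
  finally have "Lp_norm p \<omega> (S_op lam (\<lambda>x. f x * \<sigma> x)) \<le> ennreal (D powr (1 / p) * F powr (1 / p))"
    using p by (subst Lp_norm_le_iff) auto
  then show ?thesis unfolding norm_f by (simp add: ennreal_mult)
qed

section \<open>The two weight theorem\<close>

theorem theorem1p2:
  fixes p p' :: real
    and lam :: "(real ^ 'n) set \<Rightarrow> real"
    and \<sigma> \<omega> :: "real ^ 'n \<Rightarrow> real"
  assumes "1 < p"
    and "1 / p + 1 / p' = 1"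
    and "\<And>Q. Q \<in> dyadic_cubes \<Longrightarrow> 0 \<le> lam Q"
    and "locally_integrable \<sigma>" and "\<And>x. 0 < \<sigma> x"
    and "locally_integrable \<omega>" and "\<And>x. 0 < \<omega> x"
  shows
    "(\<exists>C'::real. C' \<ge> 0 \<and>
        (\<forall>f \<in> Lp_space p \<sigma>.
           Lp_norm p \<omega> (S_op lam (\<lambda>x. f x * \<sigma> x))
             \<le> ennreal C' * Lp_norm p \<sigma> (\<lambda>x. ennreal \<bar>f x\<bar>)))
     \<longleftrightarrow>
     (\<exists>C::real. C \<ge> 0 \<and>
        (\<forall>R \<in> dyadic_cubes.
           Lp_norm p \<omega> (S_loc lam R \<sigma>) \<le> ennreal (C * weight_measure \<sigma> R powr (1 / p))) \<and>
        (\<forall>R \<in> dyadic_cubes.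
           Lp_norm p' \<sigma> (S_loc lam R \<omega>) \<le> ennreal (C * weight_measure \<omega> R powr (1 / p'))))"
    (is "?bounded \<longleftrightarrow> ?testing")
proof
  note p = assms(1,2) and lam = assms(3)
  note p' = conjugate_exponent[OF p]
  have \<sigma>: "locally_integrable \<sigma>" "\<And>x. 0 \<le> \<sigma> x" and \<omega>: "locally_integrable \<omega>" "\<And>x. 0 \<le> \<omega> x"
    using assms(4-7) by (auto intro: less_imp_le)
  let ?a = "normalized_coeff lam"
  define m where "m I P = weight_measure \<sigma> (dyadic_family.atom I P)" for I P
  define n where "n I P = weight_measure \<omega> (dyadic_family.atom I P)" for I P
  have m0: "0 \<le> m I P" and n0: "0 \<le> n I P" for I P
    using \<sigma>(2) \<omega>(2) by (auto simp: m_def n_def intro!: weight_measure_nonneg)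
  {
    assume ?bounded
    then obtain C' where C': "0 \<le> C'"
      and bounded: "\<And>f. f \<in> Lp_space p \<sigma> \<Longrightarrow> Lp_norm p \<omega> (S_op lam (\<lambda>x. f x * \<sigma> x))
        \<le> ennreal C' * Lp_norm p \<sigma> (\<lambda>x. ennreal \<bar>f x\<bar>)"
      by blast
    \<comment> \<open>enlarging \<open>C'\<close> by 1 gives the positive constant that the duality argument needs\<close>
    define B where "B = (C' + 1) powr p"
    have B: "0 < B" using C' by (simp add: B_def)
    define B' where "B' = 2 * (2 * B) powr (1 / (p - 1))"
    have discrete: "finite_forest.testing I p ?a (m I) (n I) B \<and> finite_forest.testing I p' ?a (n I) (m I) B'"
      if "dyadic_family I" for I
    proof -
      interpret dyadic_family I by (rule that)
      have a0: "0 \<le> ?a Q" if "Q \<in> I" for Q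
        using that lam dyadic by (intro normalized_coeff_nonneg) auto
      have "strong_type p ?a (m I) (n I) B"
        unfolding B_def m_def n_def
      proof (rule strong_type_if_Lp_bounded[OF p(1) _ lam \<sigma> \<omega>])
        fix f assume "f \<in> Lp_space p \<sigma>"
        from bounded[OF this] show "Lp_norm p \<omega> (S_op lam (\<lambda>x. f x * \<sigma> x))
            \<le> ennreal (C' + 1) * Lp_norm p \<sigma> (\<lambda>x. ennreal \<bar>f x\<bar>)"
          by (rule order_trans) (intro mult_right_mono ennreal_leI, auto)
      qed (use C' in auto)
      then show ?thesis
        unfolding B'_def using m0 n0 a0 B p
        by (intro conjI testing_if_strong_type dual_testing_if_strong_type[OF p])
    qed
    define C where "C = max (B powr (1 / p)) (B' powr (1 / p'))"
    have "Lp_norm p \<omega> (S_loc lam R \<sigma>) \<le> ennreal (C * weight_measure \<sigma> R powr (1 / p))"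
      if "R \<in> dyadic_cubes" for R
    proof -
      have "Lp_norm p \<omega> (S_loc lam R \<sigma>) \<le> ennreal (B powr (1 / p) * weight_measure \<sigma> R powr (1 / p))"
        using B discrete unfolding m_def n_def
        by (intro Lp_testing_if_testing[OF p(1) _ lam \<sigma> \<omega> _ that]) auto
      also have "\<dots> \<le> ennreal (C * weight_measure \<sigma> R powr (1 / p))"
        by (intro ennreal_leI mult_right_mono) (auto simp: C_def)
      finally show ?thesis .
    qed
    moreover have "Lp_norm p' \<sigma> (S_loc lam R \<omega>) \<le> ennreal (C * weight_measure \<omega> R powr (1 / p'))"
      if "R \<in> dyadic_cubes" for R
    proof -
      have "Lp_norm p' \<sigma> (S_loc lam R \<omega>) \<le> ennreal (B' powr (1 / p') * weight_measure \<omega> R powr (1 / p'))"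
        using discrete unfolding m_def n_def
        by (intro Lp_testing_if_testing[OF p'(1) _ lam \<omega> \<sigma> _ that]) (auto simp: B'_def)
      also have "\<dots> \<le> ennreal (C * weight_measure \<omega> R powr (1 / p'))"
        by (intro ennreal_leI mult_right_mono) (auto simp: C_def)
      finally show ?thesis .
    qed
    moreover have "0 \<le> C" by (simp add: C_def le_max_iff_disj)
    ultimately show ?testing
      by (intro exI[of _ C] conjI ballI)
  next
    assume ?testing
    then obtain C where C: "0 \<le> C"
      and test: "\<And>R. R \<in> dyadic_cubes \<Longrightarrow>
        Lp_norm p \<omega> (S_loc lam R \<sigma>) \<le> ennreal (C * weight_measure \<sigma> R powr (1 / p))"
      and dual_test: "\<And>R. R \<in> dyadic_cubes \<Longrightarrow>
        Lp_norm p' \<sigma> (S_loc lam R \<omega>) \<le> ennreal (C * weight_measure \<omega> R powr (1 / p'))"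
      by blast
    define D where "D = max (C powr p) (C powr p')"
    have D: "0 \<le> D" by (simp add: D_def le_max_iff_disj)
    define K where "K = 2 * (D + 1) * (carleson_const p + carleson_const p') + 2"
    have strong: "finite_forest.strong_type I p ?a (m I) (n I) ((2 * K) powr (p' / (p' - 1)))"
      if "dyadic_family I" for I
    proof -
      interpret dyadic_family I by (rule that)
      have a0: "0 \<le> ?a Q" if "Q \<in> I" for Q
        using that lam dyadic by (intro normalized_coeff_nonneg) auto
      have "testing p ?a (m I) (n I) (C powr p)"
        unfolding m_def n_def by (rule testing_if_Lp_testing[OF p(1) C lam \<sigma> \<omega> test])
      then have "testing p ?a (m I) (n I) D"
        by (rule testing_mono) (auto simp: D_def m0)
      moreover have "testing p' ?a (n I) (m I) (C powr p')"
        unfolding m_def n_def by (rule testing_if_Lp_testing[OF p'(1) C lam \<omega> \<sigma> dual_test])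
      then have "testing p' ?a (n I) (m I) D"
        by (rule testing_mono) (auto simp: D_def n0)
      ultimately show ?thesis
        using m0 n0 a0 D K_def by (intro strong_type_if_testing[OF p])
    qed
    show ?bounded
    proof (intro exI conjI ballI)
      fix f assume "f \<in> Lp_space p \<sigma>"
      then show "Lp_norm p \<omega> (S_op lam (\<lambda>x. f x * \<sigma> x))
          \<le> ennreal (((2 * K) powr (p' / (p' - 1))) powr (1 / p)) * Lp_norm p \<sigma> (\<lambda>x. ennreal \<bar>f x\<bar>)"
        using strong unfolding m_def n_def
        by (intro Lp_bounded_if_strong_type[OF p(1) _ lam \<sigma> \<omega>]) auto
    qed simp
  }
qed

end
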